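(* Let $\mathcal A:\mathbb R^{n_1\times n_2}\to\mathbb R^m$ be linear and suppose there is $\Delta>0$ such that $\|\mathbf H\|_*\ge\sqrt{m/\Delta}\,\|\mathbf H\|_F$ for all nonzero $\mathbf H\in\mathrm{Null}(\mathcal A)$. Fix $c>0$ and $\alpha>0$. If $m\ge(2+c/\alpha)^2r\Delta$, then every $\mathbf H\in\mathrm{Null}(\mathcal A)$ satisfies $(1+c/\alpha)\sum_{i=1}^r\sigma_i(\mathbf H)\le\sum_{i>r}\sigma_i(\mathbf H)$; consequently every $\mathbf X^0$ of rank at most $r$ with $\|\mathbf X^0\|_2=c$ is the unique solution of problem (N2) with $\mathbf b=\mathcal A(\mathbf X^0)$.
   Context: Problem (N2) is $\min_{\mathbf X}\{\|\mathbf X\|_*+\frac{1}{2\alpha}\|\mathbf X\|_F^2:\ \mathcal A(\mathbf X)=\mathbf b\}$. $\sigma_i(\cdot)$ is the $i$-th largest singular value; $\|\cdot\|_*$, $\|\cdot\|_F$, $\|\cdot\|_2$ are nuclear, Frobenius, spectral norms. *)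

theory Defs
  imports "Jordan_Normal_Form.DL_Rank_Submatrix" "Jordan_Normal_Form.Char_Poly"
begin

definition sing_vals :: "real mat \<Rightarrow> real list" where
  "sing_vals A = rev (sorted_list_of_multiset
      (image_mset sqrt (proots (char_poly (transpose_mat A * A)))))"

text \<open>sigma A i is the i-th largest singular value (1-based); 0 beyond the list.\<close>
definition sigma :: "real mat \<Rightarrow> nat \<Rightarrow> real" where
  "sigma A i = (if 1 \<le> i \<and> i \<le> length (sing_vals A) then sing_vals A ! (i - 1) else 0)"

definition nuc_norm :: "real mat \<Rightarrow> real" where
  "nuc_norm A = sum_list (sing_vals A)"

definition fro_norm :: "real mat \<Rightarrow> real" where
  "fro_norm A = sqrt (\<Sum>i<dim_row A. \<Sum>j<dim_col A. (A $$ (i, j))\<^sup>2)"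

definition spec_norm :: "real mat \<Rightarrow> real" where
  "spec_norm A = sigma A 1"

definition mat_rank :: "real mat \<Rightarrow> nat" where
  "mat_rank A = vec_space.rank (dim_row A) A"

definition lin_meas :: "nat \<Rightarrow> nat \<Rightarrow> nat \<Rightarrow> (real mat \<Rightarrow> real vec) \<Rightarrow> bool" where
  "lin_meas n1 n2 m \<A> \<longleftrightarrow>
     (\<forall>X \<in> carrier_mat n1 n2. \<A> X \<in> carrier_vec m) \<and>
     (\<forall>X \<in> carrier_mat n1 n2. \<forall>Y \<in> carrier_mat n1 n2. \<A> (X + Y) = \<A> X + \<A> Y) \<and>
     (\<forall>X \<in> carrier_mat n1 n2. \<forall>a::real. \<A> (a \<cdot>\<^sub>m X) = a \<cdot>\<^sub>v \<A> X)"

definition null_space_op :: "nat \<Rightarrow> nat \<Rightarrow> nat \<Rightarrow> (real mat \<Rightarrow> real vec) \<Rightarrow> real mat set" where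
  "null_space_op n1 n2 m \<A> = {H \<in> carrier_mat n1 n2. \<A> H = 0\<^sub>v m}"

definition N2_obj :: "real \<Rightarrow> real mat \<Rightarrow> real" where
  "N2_obj \<alpha> X = nuc_norm X + 1 / (2 * \<alpha>) * (fro_norm X)\<^sup>2"

definition N2_unique_sol :: "nat \<Rightarrow> nat \<Rightarrow> (real mat \<Rightarrow> real vec) \<Rightarrow> real vec \<Rightarrow> real \<Rightarrow> real mat \<Rightarrow> bool" where
  "N2_unique_sol n1 n2 \<A> b \<alpha> X \<longleftrightarrow>
     X \<in> carrier_mat n1 n2 \<and> \<A> X = b \<and>
     (\<forall>Y \<in> carrier_mat n1 n2. \<A> Y = b \<longrightarrow> Y \<noteq> X \<longrightarrow> N2_obj \<alpha> X < N2_obj \<alpha> Y)"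

end

theory Submission
  imports Defs "HOL-Analysis.Function_Topology" "HOL-Analysis.Convex"
begin

text \<open>
  The first claim is Cauchy-Schwarz: the sum of the \<open>r\<close> largest singular values is at most
  \<open>sqrt r\<close> times the Frobenius norm, hence at most \<open>1 / (2 + c / \<alpha>)\<close> times the nuclear norm.

  For the second claim let \<open>s\<close> and \<open>t\<close> be the singular values of \<open>X0\<close> (rank at most \<open>r\<close>) and of
  \<open>H\<close> in the null space. The objective at \<open>X0 + H\<close> is bounded below by two estimates. The inner
  product of \<open>X0\<close> and \<open>H\<close> is at least \<open>- c\<close> times the sum of the first \<open>r\<close> of the \<open>t j\<close>
  (von Neumann), and the nuclear norm of \<open>Y = X0 + H\<close> is at least that of \<open>X0\<close> minus the first
  \<open>r\<close> of the \<open>t j\<close> plus the remaining ones (a case of Mirsky's inequality). For the latter,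
  write \<open>~\<close> for the symmetric dilation \<open>[[0, A], [A^T, 0]]\<close>, whose eigenvalues are plus and minus
  the singular values and zeros. With \<open>P\<close> the negative part of \<open>Y~\<close>, the matrix \<open>C = X0~ + P\<close>
  dominates both \<open>X0~\<close> and \<open>- H~\<close> and has trace equal to the nuclear norm of \<open>Y\<close>; so
  by Weyl monotonicity each eigenvalue of \<open>C\<close> may be bounded below by the eigenvalue of \<open>X0~\<close> or of
  \<open>- H~\<close> of the same index, whichever is better, and summing gives the claim.
  The term \<open>norm H ^ 2 / (2 * \<alpha>)\<close> makes the final inequality strict.
\<close>

section \<open>Spectral theorem for symmetric real matrices\<close>

text \<open>
  Vectors and matrices are functions on \<open>nat\<close>; the dimensions are arguments of the operations,
  and values outside the index range are irrelevant.
\<close>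

definition ip :: "nat \<Rightarrow> (nat \<Rightarrow> real) \<Rightarrow> (nat \<Rightarrow> real) \<Rightarrow> real" where
  "ip n x y = (\<Sum>i<n. x i * y i)"

definition mv :: "nat \<Rightarrow> (nat \<Rightarrow> nat \<Rightarrow> real) \<Rightarrow> (nat \<Rightarrow> real) \<Rightarrow> nat \<Rightarrow> real" where
  "mv n S x = (\<lambda>a. \<Sum>b<n. S a b * x b)"

lemma ip_commute: "ip n x y = ip n y x"
  by (simp add: ip_def mult.commute)

lemma ip_sum_left: "ip n (\<lambda>i. \<Sum>j\<in>J. c j * f j i) y = (\<Sum>j\<in>J. c j * ip n (f j) y)"
  unfolding ip_def sum_distrib_right sum_distrib_left
  by (subst sum.swap) (simp add: mult.assoc)

lemma ip_sum_right: "ip n y (\<lambda>i. \<Sum>j\<in>J. c j * f j i) = (\<Sum>j\<in>J. c j * ip n y (f j))"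
  by (subst ip_commute, subst ip_sum_left) (simp add: ip_commute)

lemma ip_add_scaled_left: "ip n (\<lambda>i. x i + t * z i) y = ip n x y + t * ip n z y"
  by (simp add: ip_def sum.distrib sum_distrib_left algebra_simps)

lemma ip_add_scaled_right: "ip n y (\<lambda>i. x i + t * z i) = ip n y x + t * ip n y z"
  by (simp add: ip_def sum.distrib sum_distrib_left algebra_simps)

lemma ip_scaled_left: "ip n (\<lambda>i. t * z i) y = t * ip n z y"
  by (simp add: ip_def sum_distrib_left algebra_simps)

lemma ip_scaled_right: "ip n y (\<lambda>i. t * z i) = t * ip n y z"
  by (simp add: ip_def sum_distrib_left algebra_simps)

lemma ip_cong: "(\<And>i. i < n \<Longrightarrow> x i = x' i) \<Longrightarrow> (\<And>i. i < n \<Longrightarrow> y i = y' i) \<Longrightarrow> ip n x y = ip n x' y'"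
  by (simp add: ip_def)

lemma ip_self_nonneg: "0 \<le> ip n x x"
  by (simp add: ip_def sum_nonneg)

lemma ip_self_eq_0_iff: "ip n x x = 0 \<longleftrightarrow> (\<forall>i<n. x i = 0)"
  by (auto simp: ip_def sum_nonneg_eq_0_iff)

lemma ip_eq_0_of_self_eq_0: "ip n x x = 0 \<Longrightarrow> ip n x y = 0"
  unfolding ip_self_eq_0_iff by (simp add: ip_def)

lemma mv_add_scaled: "mv n S (\<lambda>i. x i + t * z i) = (\<lambda>a. mv n S x a + t * mv n S z a)"
  by (simp add: mv_def fun_eq_iff sum.distrib sum_distrib_left algebra_simps)

lemma mv_scaled: "mv n S (\<lambda>i. t * z i) = (\<lambda>a. t * mv n S z a)"
  by (simp add: mv_def fun_eq_iff sum_distrib_left algebra_simps)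

lemma mv_cong: "(\<And>i. i < n \<Longrightarrow> x i = y i) \<Longrightarrow> mv n S x = mv n S y"
  by (simp add: mv_def)

lemma ip_mv_symmetric:
  assumes "\<And>i j. i < n \<Longrightarrow> j < n \<Longrightarrow> S i j = S j i"
  shows "ip n x (mv n S y) = ip n y (mv n S x)"
proof -
  have "ip n x (mv n S y) = (\<Sum>i<n. \<Sum>j<n. S i j * x i * y j)"
    by (simp add: ip_def mv_def sum_distrib_left mult.assoc mult.left_commute)
  also have "\<dots> = (\<Sum>j<n. \<Sum>i<n. S i j * x i * y j)" by (rule sum.swap)
  also have "\<dots> = (\<Sum>j<n. \<Sum>i<n. S j i * x i * y j)"
    by (intro sum.cong refl) (simp add: assms)
  also have "\<dots> = ip n y (mv n S x)"
    by (simp add: ip_def mv_def sum_distrib_left mult.assoc mult.left_commute mult.commute)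
  finally show ?thesis .
qed

section \<open>Maximizers of a quadratic form under orthogonality constraints\<close>

text \<open>Padding the \<open>k\<close> equations with zero rows gives a singular square matrix,
  and its kernel supplies \<open>w\<close>. This is the dimension count behind every min-max
  argument below.\<close>

lemma underdetermined_nonzero_solution:
  fixes a :: "nat \<Rightarrow> nat \<Rightarrow> real"
  assumes "k < n"
  obtains w where "\<exists>j<n. w j \<noteq> 0" "\<And>l. l < k \<Longrightarrow> (\<Sum>j<n. a l j * w j) = 0"
proof -
  define M where "M = mat n n (\<lambda>(l, j). if l < k then a l j else 0)"
  have M: "M \<in> carrier_mat n n" by (simp add: M_def)
  have "det M = (\<Sum>j<n. M $$ (k, j) * cofactor M k j)" by (rule laplace_expansion_row[OF M assms])
  also have "\<dots> = 0" using assms by (intro sum.neutral) (simp add: M_def)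
  finally have "det M = 0" .
  then obtain v where v: "v \<in> carrier_vec n" "v \<noteq> 0\<^sub>v n" "M *\<^sub>v v = 0\<^sub>v n"
    using det_0_iff_vec_prod_zero_field[OF M] by blast
  show thesis
  proof (rule that[of "\<lambda>j. v $ j"])
    show "\<exists>j<n. v $ j \<noteq> 0" using v(1,2) by (metis carrier_vecD eq_vecI index_zero_vec)
    fix l assume l: "l < k"
    have "(M *\<^sub>v v) $ l = (\<Sum>j<n. a l j * v $ j)"
      using l assms v(1) by (simp add: M_def scalar_prod_def lessThan_atLeast0)
    thus "(\<Sum>j<n. a l j * v $ j) = 0" using v(3) l assms by simp
  qed
qed

text \<open>Pinning the coordinates from \<open>n\<close> on to 0 makes this a product of compact
  sets, so Tychonoff's theorem applies in the product topology on
  \<open>nat => real\<close>.\<close>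

lemma compact_coordinate_box: "compact {x :: nat \<Rightarrow> real. \<forall>i. x i \<in> (if i < n then {-1..1} else {0})}"
proof -
  have "compactin (product_topology (\<lambda>i. euclidean) UNIV)
      (PiE UNIV (\<lambda>i. if i < n then {-1..1::real} else {0}))"
    unfolding compactin_PiE by (auto simp: compactin_euclidean_iff)
  moreover have "PiE UNIV (\<lambda>i. if i < n then {-1..1::real} else {0})
      = {x. \<forall>i. x i \<in> (if i < n then {-1..1} else {0})}"
    by (auto simp: PiE_def Pi_def)
  ultimately show ?thesis
    by (simp add: euclidean_product_topology compactin_euclidean_iff)
qed

lemma Rayleigh_maximizer:
  fixes f S :: "nat \<Rightarrow> nat \<Rightarrow> real"
  assumes "k < n"
  obtains x where "\<And>j. j < k \<Longrightarrow> ip n x (f j) = 0" "ip n x x = 1"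
    "\<And>y. (\<And>j. j < k \<Longrightarrow> ip n y (f j) = 0) \<Longrightarrow> ip n y (mv n S y) \<le> ip n x (mv n S x) * ip n y y"
proof -
  define B where "B = {x :: nat \<Rightarrow> real. \<forall>i. x i \<in> (if i < n then {-1..1} else {0})}"
  \<comment> \<open>Unit vectors have coordinates in \<open>[-1, 1]\<close>, so the box does not
    restrict the first \<open>n\<close> of them; it supplies compactness.\<close>
  define F where "F = B \<inter> ({x. ip n x x = 1} \<inter> (\<Inter>j\<in>{..<k}. {x. ip n x (f j) = 0}))"
  have cont_ip: "continuous_on UNIV (\<lambda>x. ip n x (f j))" for j
    unfolding ip_def by (intro continuous_intros) auto
  have cont_sq: "continuous_on UNIV (\<lambda>x. ip n x x)"
    unfolding ip_def by (intro continuous_intros) auto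
  have cont_q: "continuous_on UNIV (\<lambda>x. ip n x (mv n S x))"
    unfolding ip_def mv_def by (intro continuous_intros) auto
  have "compact F"
    unfolding F_def B_def
    by (intro compact_Int_closed compact_coordinate_box closed_Int closed_INT ballI
        closed_Collect_eq cont_ip cont_sq continuous_on_const)
  \<comment> \<open>Only the first \<open>n\<close> coordinates enter \<open>ip n\<close>, so an
    admissible \<open>y\<close> of nonzero norm may be truncated and rescaled into \<open>F\<close>;
    homogeneity then carries the bound from \<open>F\<close> back to \<open>y\<close>.\<close>
  have normalize: "(\<lambda>i. if i < n then y i / sqrt (ip n y y) else 0) \<in> F"
    if y: "\<And>j. j < k \<Longrightarrow> ip n y (f j) = 0" and y0: "ip n y y \<noteq> 0" for y
  proof -
    let ?g = "\<lambda>i. if i < n then y i / sqrt (ip n y y) else 0"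
    have pos: "ip n y y > 0" using y0 ip_self_nonneg[of n y] by simp
    have eq: "ip n ?g z = ip n y z / sqrt (ip n y y)" for z
      by (simp add: ip_def sum_divide_distrib)
    have "ip n ?g ?g = 1"
      using pos by (subst eq, subst ip_commute, subst eq) simp
    moreover have "?g i \<in> {-1..1}" if "i < n" for i
    proof -
      have "?g i * ?g i \<le> ip n ?g ?g"
        unfolding ip_def by (rule member_le_sum) (use that in auto)
      hence "(?g i)\<^sup>2 \<le> 1" using \<open>ip n ?g ?g = 1\<close> by (simp add: power2_eq_square)
      thus ?thesis using abs_square_le_1 by (fastforce simp: abs_le_iff)
    qed
    ultimately show ?thesis by (auto simp: F_def B_def eq y)
  qed
  obtain w where w: "\<exists>j<n. w j \<noteq> 0" "\<And>l. l < k \<Longrightarrow> (\<Sum>j<n. f l j * w j) = 0"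
    using underdetermined_nonzero_solution[OF assms, of f] by blast
  have "ip n w w \<noteq> 0" using w(1) by (auto simp: ip_self_eq_0_iff)
  moreover have "ip n w (f j) = 0" if "j < k" for j
    using w(2)[OF that] by (simp add: ip_def mult.commute)
  ultimately have "F \<noteq> {}" using normalize by blast
  then obtain x where x: "x \<in> F" "\<And>y. y \<in> F \<Longrightarrow> ip n y (mv n S y) \<le> ip n x (mv n S x)"
    using continuous_attains_sup[OF \<open>compact F\<close>] cont_q continuous_on_subset by blast
  show thesis
  proof (rule that[of x])
    show "ip n x (f j) = 0" if "j < k" for j using x(1) that by (auto simp: F_def)
    show "ip n x x = 1" using x(1) by (auto simp: F_def)
    fix y assume y: "\<And>j. j < k \<Longrightarrow> ip n y (f j) = 0"
    show "ip n y (mv n S y) \<le> ip n x (mv n S x) * ip n y y"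
    proof (cases "ip n y y = 0")
      case True
      thus ?thesis by (simp add: ip_eq_0_of_self_eq_0)
    next
      case False
      let ?g = "\<lambda>i. if i < n then y i / sqrt (ip n y y) else 0"
      let ?h = "\<lambda>i. (1 / sqrt (ip n y y)) * y i"
      have pos: "ip n y y > 0" using False ip_self_nonneg[of n y] by simp
      have "mv n S ?g = mv n S ?h" by (rule mv_cong) simp
      hence "ip n ?g (mv n S ?g) = ip n ?h (mv n S ?h)"
        by (intro ip_cong) auto
      also have "\<dots> = ip n y (mv n S y) / ip n y y"
        using pos by (simp only: mv_scaled ip_scaled_left ip_scaled_right)
          (simp add: real_sqrt_mult[symmetric])
      finally have "ip n y (mv n S y) / ip n y y \<le> ip n x (mv n S x)"
        using x(2)[OF normalize[OF y False]] by simp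
      thus ?thesis using pos by (simp add: pos_divide_le_eq)
    qed
  qed
qed

section \<open>Orthonormal eigenvectors by successive maximization\<close>

text \<open>For small \<open>t > 0\<close> a positive linear term would outweigh the quadratic one.
  This serves as the first-order condition at a maximum.\<close>

lemma eq_0_of_quadratic_nonpos:
  fixes a b :: real
  assumes "a \<ge> 0" and "\<And>t. 2 * t * a + t\<^sup>2 * b \<le> 0"
  shows "a = 0"
proof (rule ccontr)
  assume "a \<noteq> 0"
  with assms have a: "a > 0" by simp
  define t where "t = a / (\<bar>b\<bar> + 1)"
  have t: "t > 0" using a by (simp add: t_def)
  have "t * (2 * a + t * b) \<le> 0" using assms(2)[of t] by (simp add: power2_eq_square algebra_simps)
  hence "2 * a + t * b \<le> 0" using t by (simp add: mult_le_0_iff)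
  moreover have "t * \<bar>b\<bar> \<le> a" using a by (simp add: t_def field_simps)
  moreover have "t * b \<ge> - (t * \<bar>b\<bar>)" using t by (metis abs_ge_minus_self abs_mult abs_of_pos minus_le_iff)
  ultimately show False using a by linarith
qed

text \<open>Each new vector maximizes the Rayleigh quotient on the orthogonal complement of the
  earlier ones. The maximum property stays in the conclusion because the Weyl bounds rest on
  it.\<close>

lemma orthonormal_eigenvectors:
  fixes S :: "nat \<Rightarrow> nat \<Rightarrow> real"
  assumes sym: "\<And>i j. i < n \<Longrightarrow> j < n \<Longrightarrow> S i j = S j i" and "k \<le> n"
  shows "\<exists>d v. (\<forall>i<k. \<forall>j<k. ip n (v i) (v j) = (if i = j then 1 else 0)) \<and>
     (\<forall>i<k. \<forall>a<n. mv n S (v i) a = d i * v i a) \<and>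
     (\<forall>i<k. \<forall>y. (\<forall>j<i. ip n y (v j) = 0) \<longrightarrow> ip n y (mv n S y) \<le> d i * ip n y y)"
  using assms(2)
proof (induction k)
  case 0
  show ?case by simp
next
  case (Suc k)
  then obtain d v where ev: "\<forall>i<k. \<forall>j<k. ip n (v i) (v j) = (if i = j then 1 else 0)"
    "\<forall>i<k. \<forall>a<n. mv n S (v i) a = d i * v i a"
    "\<forall>i<k. \<forall>y. (\<forall>j<i. ip n y (v j) = 0) \<longrightarrow> ip n y (mv n S y) \<le> d i * ip n y y"
    using Suc_leD by blast
  note orth = ev(1)[rule_format] and eig = ev(2)[rule_format] and max = ev(3)[rule_format]
  have "k < n" using Suc.prems by simp
  obtain x where x0: "\<And>j. j < k \<Longrightarrow> ip n x (v j) = 0" and x1: "ip n x x = 1"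
    and xmax: "\<And>y. (\<And>j. j < k \<Longrightarrow> ip n y (v j) = 0) \<Longrightarrow> ip n y (mv n S y) \<le> ip n x (mv n S x) * ip n y y"
    using Rayleigh_maximizer[OF \<open>k < n\<close>, of v S] by blast
  define \<mu> where "\<mu> = ip n x (mv n S x)"
  \<comment> \<open>The residual \<open>w\<close> is half the gradient of the form minus \<mu> times
    the squared norm. It is orthogonal to the earlier eigenvectors, so \<open>x + t * w\<close> is
    admissible for every \<open>t\<close>; the linear coefficient in \<open>t\<close> is
    \<open>2 * ip n w w\<close>, which forces \<open>w\<close> to vanish.\<close>
  define w where "w = (\<lambda>i. mv n S x i + (- \<mu>) * x i)"
  have w0: "ip n w (v j) = 0" if "j < k" for j
  proof -
    have "ip n (mv n S x) (v j) = ip n x (mv n S (v j))"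
      by (subst ip_commute) (rule ip_mv_symmetric[OF sym])
    also have "\<dots> = ip n x (\<lambda>i. d j * v j i)" using eig[OF that] by (intro ip_cong) auto
    finally show ?thesis
      unfolding w_def ip_add_scaled_left using x0[OF that] by (simp add: ip_scaled_right)
  qed
  have "ip n w w = 0"
  proof (rule eq_0_of_quadratic_nonpos)
    show "ip n w w \<ge> 0" by (rule ip_self_nonneg)
    fix t :: real
    let ?y = "\<lambda>i. x i + t * w i"
    have "ip n ?y (mv n S ?y) \<le> \<mu> * ip n ?y ?y"
      unfolding \<mu>_def by (rule xmax) (simp add: ip_add_scaled_left x0 w0)
    moreover have "ip n ?y (mv n S ?y) = \<mu> + 2 * t * ip n w (mv n S x) + t\<^sup>2 * ip n w (mv n S w)"
      using ip_mv_symmetric[of n S x w, OF sym]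
      by (simp add: mv_add_scaled ip_add_scaled_left ip_add_scaled_right \<mu>_def power2_eq_square algebra_simps)
    moreover have "ip n ?y ?y = 1 + 2 * t * ip n w x + t\<^sup>2 * ip n w w"
      by (simp add: ip_add_scaled_left ip_add_scaled_right x1 ip_commute[of n x w] power2_eq_square algebra_simps)
    moreover have "ip n w (mv n S x) = ip n w w + \<mu> * ip n w x"
      using ip_add_scaled_right[of n w "mv n S x" "- \<mu>" x, folded w_def] by simp
    ultimately show "2 * t * ip n w w + t\<^sup>2 * (ip n w (mv n S w) - \<mu> * ip n w w) \<le> 0"
      by (simp add: algebra_simps)
  qed
  hence xe: "mv n S x a = \<mu> * x a" if "a < n" for a
    using that unfolding ip_self_eq_0_iff w_def by force
  let ?d = "d(k := \<mu>)" and ?v = "v(k := x)"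
  show ?case
  proof (intro exI[of _ ?d] exI[of _ ?v] conjI allI impI)
    fix i j assume "i < Suc k" "j < Suc k"
    thus "ip n (?v i) (?v j) = (if i = j then 1 else 0)"
      using orth x0 x1 by (auto simp: less_Suc_eq ip_commute[of n "v _" x])
  next
    fix i a assume "i < Suc k" "a < n"
    thus "mv n S (?v i) a = ?d i * ?v i a" using eig xe by (auto simp: less_Suc_eq)
  next
    fix i y assume i: "i < Suc k" and y: "\<forall>j<i. ip n y (?v j) = 0"
    hence "\<And>j. j < i \<Longrightarrow> ip n y (v j) = 0" by (metis fun_upd_other less_Suc_eq not_less_eq)
    thus "ip n y (mv n S y) \<le> ?d i * ip n y y"
      using i max[of i y] xmax[of y] by (auto simp: less_Suc_eq \<mu>_def)
  qed
qed

definition orthonormal :: "nat \<Rightarrow> nat \<Rightarrow> (nat \<Rightarrow> nat \<Rightarrow> real) \<Rightarrow> bool" where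
  "orthonormal n k v \<longleftrightarrow> (\<forall>i<k. \<forall>j<k. ip n (v i) (v j) = (if i = j then 1 else 0))"

text \<open>A square matrix with orthonormal columns has orthonormal rows, since a left inverse is
  also a right inverse.\<close>

lemma orthonormal_complete:
  assumes "orthonormal n n v" "a < n" "b < n"
  shows "(\<Sum>k<n. v k a * v k b) = (if a = b then 1 else 0)"
proof -
  define Q where "Q = mat n n (\<lambda>(i, k). v k i)"
  have Q: "Q \<in> carrier_mat n n" "transpose_mat Q \<in> carrier_mat n n" by (auto simp: Q_def)
  have "transpose_mat Q * Q = 1\<^sub>m n"
    using assms(1)
    by (intro eq_matI) (auto simp: Q_def orthonormal_def ip_def scalar_prod_def lessThan_atLeast0)
  hence "Q * transpose_mat Q = 1\<^sub>m n" using mat_mult_left_right_inverse Q by blast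
  hence "(Q * transpose_mat Q) $$ (a, b) = (1\<^sub>m n) $$ (a, b)" by simp
  thus ?thesis using assms(2,3) by (simp add: Q_def scalar_prod_def lessThan_atLeast0)
qed

text \<open>\<open>Rayleigh_le\<close> is the half of the Courant-Fischer principle that the Weyl
  bounds need; \<open>entry\<close> gives the trace and the diagonalization.\<close>

locale eigen_system =
  fixes n :: nat and S :: "nat \<Rightarrow> nat \<Rightarrow> real" and d :: "nat \<Rightarrow> real" and v :: "nat \<Rightarrow> nat \<Rightarrow> real"
  assumes orthonormal_v: "orthonormal n n v"
    and eigenvector: "i < n \<Longrightarrow> a < n \<Longrightarrow> mv n S (v i) a = d i * v i a"
    and entry: "a < n \<Longrightarrow> b < n \<Longrightarrow> S a b = (\<Sum>k<n. d k * v k a * v k b)"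
    and decreasing: "i \<le> j \<Longrightarrow> j < n \<Longrightarrow> d j \<le> d i"
    and Rayleigh_le: "i < n \<Longrightarrow> (\<And>j. j < i \<Longrightarrow> ip n y (v j) = 0) \<Longrightarrow> ip n y (mv n S y) \<le> d i * ip n y y"

text \<open>Completeness turns the eigenvector equations into the expansion of \<open>S\<close>. The
  order of the eigenvalues follows by testing the maximum property of index \<open>i\<close> on a
  later eigenvector \<open>v j\<close>.\<close>

theorem spectral_decomposition:
  fixes S :: "nat \<Rightarrow> nat \<Rightarrow> real"
  assumes sym: "\<And>i j. i < n \<Longrightarrow> j < n \<Longrightarrow> S i j = S j i"
  shows "\<exists>d v. eigen_system n S d v"
proof -
  obtain d v where ev: "\<forall>i<n. \<forall>j<n. ip n (v i) (v j) = (if i = j then 1 else 0)"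
    "\<forall>i<n. \<forall>a<n. mv n S (v i) a = d i * v i a"
    "\<forall>i<n. \<forall>y. (\<forall>j<i. ip n y (v j) = 0) \<longrightarrow> ip n y (mv n S y) \<le> d i * ip n y y"
    using orthonormal_eigenvectors[of n S n, OF sym] by auto
  note orth = ev(1)[rule_format] and eig = ev(2)[rule_format] and max = ev(3)[rule_format]
  have on: "orthonormal n n v" using orth by (simp add: orthonormal_def)
  have "eigen_system n S d v"
  proof (rule eigen_system.intro[OF on eig _ _ max])
    fix a b assume ab: "a < n" "b < n"
    have "(\<Sum>k<n. d k * v k a * v k b) = (\<Sum>k<n. mv n S (v k) a * v k b)"
      using ab by (simp add: eig)
    also have "\<dots> = (\<Sum>k<n. \<Sum>c<n. S a c * (v k c * v k b))"
      by (simp add: mv_def sum_distrib_right mult.assoc)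
    also have "\<dots> = (\<Sum>c<n. S a c * (\<Sum>k<n. v k c * v k b))"
      by (subst sum.swap) (simp add: sum_distrib_left)
    also have "\<dots> = (\<Sum>c<n. S a c * (if c = b then 1 else 0))"
      using ab orthonormal_complete[OF on] by simp
    also have "\<dots> = (\<Sum>c<n. if c = b then S a c else 0)" by (intro sum.cong) auto
    also have "\<dots> = S a b" using ab by simp
    finally show "S a b = (\<Sum>k<n. d k * v k a * v k b)" by simp
  next
    fix i j assume ij: "i \<le> j" "j < n"
    have "ip n (v j) (mv n S (v j)) = ip n (v j) (\<lambda>a. d j * v j a)"
      using ij eig by (intro ip_cong) auto
    also have "\<dots> = d j" using ij orth[of j j] by (simp add: ip_scaled_right)
    finally show "d j \<le> d i" using max[of i "v j"] orth[of j] ij by auto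
  qed
  thus ?thesis by blast
qed

section \<open>Singular systems and eigenvalue bounds\<close>

definition semi_orthonormal :: "nat \<Rightarrow> nat \<Rightarrow> (nat \<Rightarrow> nat \<Rightarrow> real) \<Rightarrow> bool" where
  "semi_orthonormal n k f \<longleftrightarrow> (\<forall>i<k. ip n (f i) (f i) = 0 \<or> ip n (f i) (f i) = 1) \<and>
     (\<forall>i<k. \<forall>j<k. i \<noteq> j \<longrightarrow> ip n (f i) (f j) = 0)"

lemma orthonormal_imp_semi_orthonormal: "orthonormal n k f \<Longrightarrow> semi_orthonormal n k f"
  by (auto simp: orthonormal_def semi_orthonormal_def)

lemma semi_orthonormal_mono: "semi_orthonormal n k f \<Longrightarrow> j \<le> k \<Longrightarrow> semi_orthonormal n j f"
  by (auto simp: semi_orthonormal_def)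

lemma ip_sum_semi_orthonormal:
  assumes "semi_orthonormal n k f" "J \<subseteq> {..<k}" "j < k"
  shows "ip n (\<lambda>a. \<Sum>i\<in>J. c i * f i a) (f j) = (if j \<in> J then c j * ip n (f j) (f j) else 0)"
proof -
  have fin: "finite J" using assms(2) finite_subset by blast
  have "ip n (\<lambda>a. \<Sum>i\<in>J. c i * f i a) (f j) = (\<Sum>i\<in>J. c i * ip n (f i) (f j))"
    by (rule ip_sum_left)
  also have "\<dots> = (\<Sum>i\<in>J. if i = j then c j * ip n (f j) (f j) else 0)"
    using assms by (intro sum.cong) (auto simp: semi_orthonormal_def)
  finally show ?thesis using fin by simp
qed

lemma ip_sum_self_semi_orthonormal:
  assumes "semi_orthonormal n k f" "J \<subseteq> {..<k}"
  shows "ip n (\<lambda>a. \<Sum>i\<in>J. c i * f i a) (\<lambda>a. \<Sum>i\<in>J. c i * f i a) = (\<Sum>i\<in>J. (c i)\<^sup>2 * ip n (f i) (f i))"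
proof -
  have "ip n (\<lambda>a. \<Sum>i\<in>J. c i * f i a) (\<lambda>a. \<Sum>i\<in>J. c i * f i a)
      = (\<Sum>j\<in>J. c j * ip n (\<lambda>a. \<Sum>i\<in>J. c i * f i a) (f j))"
    by (rule ip_sum_right)
  also have "\<dots> = (\<Sum>j\<in>J. c j * (c j * ip n (f j) (f j)))"
    using assms(2) by (intro sum.cong refl) (subst ip_sum_semi_orthonormal[OF assms], auto)
  finally show ?thesis by (simp add: power2_eq_square mult.assoc)
qed

lemma Bessel_inequality:
  assumes "semi_orthonormal n k f"
  shows "(\<Sum>j<k. (ip n (f j) x)\<^sup>2) \<le> ip n x x"
proof -
  define c where "c j = ip n (f j) x" for j
  define p where "p = (\<lambda>a. \<Sum>j<k. c j * f j a)"
  \<comment> \<open>If \<open>f j\<close> has norm 0, its coefficient \<open>c j\<close> vanishes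
    too, so the factor \<open>ip n (f j) (f j)\<close> can always be dropped.\<close>
  have cc: "(c j)\<^sup>2 * ip n (f j) (f j) = (c j)\<^sup>2" if "j < k" for j
    using assms that ip_eq_0_of_self_eq_0[of n "f j" x] unfolding semi_orthonormal_def c_def by fastforce
  have pp: "ip n p p = (\<Sum>j<k. (c j)\<^sup>2)"
    unfolding p_def by (subst ip_sum_self_semi_orthonormal[OF assms]) (auto simp: cc)
  have px: "ip n p x = (\<Sum>j<k. (c j)\<^sup>2)"
    unfolding p_def ip_sum_left by (simp add: c_def power2_eq_square)
  have "0 \<le> ip n (\<lambda>a. x a + (-1) * p a) (\<lambda>a. x a + (-1) * p a)" by (rule ip_self_nonneg)
  also have "\<dots> = ip n x x - 2 * ip n p x + ip n p p"
    unfolding ip_add_scaled_left ip_add_scaled_right ip_commute[of n x p] by simp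
  finally show ?thesis using pp px by (simp add: c_def)
qed

lemma signed_AM_GM:
  fixes a b \<epsilon> :: real
  assumes "\<epsilon> * \<epsilon> = 1"
  shows "- ((a\<^sup>2 + b\<^sup>2) / 2) \<le> \<epsilon> * a * b"
proof -
  have "0 \<le> (\<epsilon> * a + b)\<^sup>2" by simp
  also have "\<dots> = (\<epsilon> * \<epsilon>) * a\<^sup>2 + b\<^sup>2 + 2 * (\<epsilon> * a * b)"
    by (simp add: power2_eq_square algebra_simps)
  finally show ?thesis unfolding assms by (simp add: field_simps)
qed

section \<open>Bilinear forms, singular systems and Weyl bounds\<close>

definition bil :: "nat \<Rightarrow> nat \<Rightarrow> (nat \<Rightarrow> nat \<Rightarrow> real) \<Rightarrow> (nat \<Rightarrow> real) \<Rightarrow> (nat \<Rightarrow> real) \<Rightarrow> real" where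
  "bil n1 n2 A x y = (\<Sum>i<n1. \<Sum>l<n2. A i l * x i * y l)"

lemma bil_rank_one_sum:
  assumes "\<And>i l. i < n1 \<Longrightarrow> l < n2 \<Longrightarrow> A i l = (\<Sum>k<m. s k * u k i * v k l)"
  shows "bil n1 n2 A x y = (\<Sum>k<m. s k * ip n1 (u k) x * ip n2 (v k) y)"
proof -
  have "bil n1 n2 A x y = (\<Sum>i<n1. \<Sum>l<n2. \<Sum>k<m. s k * (u k i * x i) * (v k l * y l))"
    unfolding bil_def by (intro sum.cong refl) (simp add: assms sum_distrib_left sum_distrib_right ac_simps)
  also have "\<dots> = (\<Sum>i<n1. \<Sum>k<m. \<Sum>l<n2. s k * (u k i * x i) * (v k l * y l))"
    by (intro sum.cong refl sum.swap)
  also have "\<dots> = (\<Sum>k<m. \<Sum>i<n1. \<Sum>l<n2. s k * (u k i * x i) * (v k l * y l))"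
    by (rule sum.swap)
  also have "\<dots> = (\<Sum>k<m. (\<Sum>i<n1. s k * (u k i * x i)) * (\<Sum>l<n2. v k l * y l))"
    by (intro sum.cong refl sum_product[symmetric])
  also have "\<dots> = (\<Sum>k<m. s k * ip n1 (u k) x * ip n2 (v k) y)"
    by (simp only: ip_def sum_distrib_left)
  finally show ?thesis .
qed

lemma sum_lessThan_add:
  fixes g :: "nat \<Rightarrow> 'a::comm_monoid_add"
  shows "(\<Sum>i<n1+n2. g i) = (\<Sum>i<n1. g i) + (\<Sum>i<n2. g (n1 + i))"
  by (induction n2) (auto simp: add.assoc)

lemma ip_add_dim: "ip (n1 + n2) x y = ip n1 x y + ip n2 (\<lambda>l. x (n1 + l)) (\<lambda>l. y (n1 + l))"
  unfolding ip_def by (rule sum_lessThan_add)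

text \<open>
  All \<open>n2\<close> right singular vectors are kept; the left one is the zero vector where \<open>s k = 0\<close>,
  so that no case distinction on \<open>n1\<close> and \<open>n2\<close> is needed.
\<close>

locale svd_of =
  fixes n1 n2 :: nat and A :: "nat \<Rightarrow> nat \<Rightarrow> real" and s :: "nat \<Rightarrow> real" and u v :: "nat \<Rightarrow> nat \<Rightarrow> real"
  assumes entry: "i < n1 \<Longrightarrow> l < n2 \<Longrightarrow> A i l = (\<Sum>k<n2. s k * u k i * v k l)"
    and decreasing: "i \<le> j \<Longrightarrow> j < n2 \<Longrightarrow> s j \<le> s i"
    and nonneg: "j < n2 \<Longrightarrow> 0 \<le> s j"
    and orthonormal_v: "orthonormal n2 n2 v"
    and ip_u: "i < n2 \<Longrightarrow> j < n2 \<Longrightarrow> ip n1 (u i) (u j) = (if i = j \<and> s i \<noteq> 0 then 1 else 0)"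
begin

lemma semi_orthonormal_u: "semi_orthonormal n1 n2 u"
  by (auto simp: semi_orthonormal_def ip_u)

lemma semi_orthonormal_v: "semi_orthonormal n2 n2 v"
  by (rule orthonormal_imp_semi_orthonormal[OF orthonormal_v])

lemma ip_v: "i < n2 \<Longrightarrow> j < n2 \<Longrightarrow> ip n2 (v i) (v j) = (if i = j then 1 else 0)"
  using orthonormal_v by (simp add: orthonormal_def)

lemma bil_eq: "bil n1 n2 A x y = (\<Sum>k<n2. s k * ip n1 (u k) x * ip n2 (v k) y)"
  by (rule bil_rank_one_sum) (rule entry)

text \<open>
  Both Weyl bounds refer to a quadratic form \<open>q\<close> dominating \<open>\<epsilon>\<close> times the dilation of \<open>A\<close>, and
  to a number \<open>\<mu>\<close> in the role of its eigenvalue of index \<open>i\<close> (counted from 0).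
\<close>

lemma sing_le_eigenvalue:
  assumes max: "\<And>y. (\<And>j. j < i \<Longrightarrow> ip (n1 + n2) y (c j) = 0) \<Longrightarrow> q y \<le> \<mu> * ip (n1 + n2) y y"
    and dominates: "\<And>z. 2 * \<epsilon> * bil n1 n2 A z (\<lambda>l. z (n1 + l)) \<le> q z"
    and eps: "\<epsilon> * \<epsilon> = 1" and i: "i < n2" and pos: "s i > 0"
  shows "s i \<le> \<mu>"
proof -
  \<comment> \<open>For \<open>s j > 0\<close> the vector \<open>z j\<close> is an eigenvector of
    \<epsilon> times the dilation with eigenvalue \<open>s j\<close>. The span of the first
    \<open>i + 1\<close> of them contains a nonzero vector orthogonal to the \<open>i\<close>
    vectors \<open>c l\<close>.\<close>
  define z where "z j = (\<lambda>a. if a < n1 then \<epsilon> * u j a else v j (a - n1))" for j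
  obtain w where w: "\<exists>j<Suc i. w j \<noteq> 0" "\<And>l. l < i \<Longrightarrow> (\<Sum>j<Suc i. ip (n1 + n2) (z j) (c l) * w j) = 0"
    using underdetermined_nonzero_solution[of i "Suc i" "\<lambda>l j. ip (n1 + n2) (z j) (c l)"] by blast
  define y where "y = (\<lambda>a. \<Sum>j<Suc i. w j * z j a)"
  define x1 where "x1 = (\<lambda>a. \<Sum>j<Suc i. (\<epsilon> * w j) * u j a)"
  define x2 where "x2 = (\<lambda>a. \<Sum>j<Suc i. w j * v j a)"
  define W where "W = (\<Sum>j<Suc i. (w j)\<^sup>2)"
  have sub: "{..<Suc i} \<subseteq> {..<n2}" using i by auto
  have spos: "s j > 0" if "j < Suc i" for j using decreasing[of j i] that i pos by auto
  have eps2: "\<epsilon>\<^sup>2 = 1" using eps by (simp add: power2_eq_square)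
  have y1: "y a = x1 a" if "a < n1" for a using that by (simp add: y_def x1_def z_def ac_simps)
  have y2: "(\<lambda>l. y (n1 + l)) = x2" by (simp add: y_def x2_def z_def)
  have "ip n1 x1 x1 = W"
    unfolding x1_def ip_sum_self_semi_orthonormal[OF semi_orthonormal_u sub] W_def
    using sub spos by (intro sum.cong refl) (auto simp: ip_u power_mult_distrib eps2 less_imp_neq[symmetric])
  moreover have "ip n2 x2 x2 = W"
    unfolding x2_def ip_sum_self_semi_orthonormal[OF semi_orthonormal_v sub] W_def
    using sub by (intro sum.cong refl) (auto simp: ip_v)
  ultimately have yy: "ip (n1 + n2) y y = 2 * W"
    unfolding ip_add_dim y2 using ip_cong[of n1 y x1 y x1] y1 by simp
  have "W \<ge> 0" by (simp add: W_def sum_nonneg)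
  moreover have "W \<noteq> 0" using w(1) by (auto simp: W_def sum_nonneg_eq_0_iff simp del: sum.lessThan_Suc)
  ultimately have "W > 0" by simp
  \<comment> \<open>On this span the form of \<epsilon> times the dilation is at least
    \<open>s i\<close> times the squared norm, which is \<open>2 * W\<close>.\<close>
  have "s i * W \<le> \<epsilon> * bil n1 n2 A y (\<lambda>l. y (n1 + l))"
  proof -
    have "ip n1 (u k) y = (if k < Suc i then \<epsilon> * w k else 0)" if "k < n2" for k
    proof -
      have "ip n1 (u k) y = ip n1 x1 (u k)" using y1 by (subst ip_commute, intro ip_cong) auto
      also have "\<dots> = (if k < Suc i then \<epsilon> * w k else 0)"
        unfolding x1_def ip_sum_semi_orthonormal[OF semi_orthonormal_u sub that]
        using that spos[of k] by (auto simp: ip_u)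
      finally show ?thesis .
    qed
    moreover have "ip n2 (v k) x2 = (if k < Suc i then w k else 0)" if "k < n2" for k
      using ip_sum_semi_orthonormal[OF semi_orthonormal_v sub that, of w] that
      by (simp add: x2_def ip_v ip_commute)
    ultimately have "bil n1 n2 A y x2 = (\<Sum>k<n2. if k < Suc i then \<epsilon> * (s k * (w k)\<^sup>2) else 0)"
      unfolding bil_eq by (intro sum.cong refl) (auto simp: power2_eq_square)
    also have "\<dots> = (\<Sum>k<Suc i. \<epsilon> * (s k * (w k)\<^sup>2))"
      using sub by (intro sum.mono_neutral_cong_right) auto
    finally have "\<epsilon> * bil n1 n2 A y x2 = (\<Sum>k<Suc i. \<epsilon> * (\<epsilon> * (s k * (w k)\<^sup>2)))"
      by (simp only: sum_distrib_left)
    also have "\<dots> = (\<Sum>k<Suc i. s k * (w k)\<^sup>2)"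
      using eps by (simp add: mult.assoc[symmetric] del: sum.lessThan_Suc)
    finally have "\<epsilon> * bil n1 n2 A y x2 = (\<Sum>k<Suc i. s k * (w k)\<^sup>2)" .
    moreover have "s i * W \<le> (\<Sum>k<Suc i. s k * (w k)\<^sup>2)"
      unfolding W_def sum_distrib_left using decreasing i by (intro sum_mono mult_right_mono) auto
    ultimately show ?thesis by (simp add: y2)
  qed
  hence "2 * (s i * W) \<le> q y" using dominates[of y] by simp
  also have "\<dots> \<le> \<mu> * (2 * W)"
    unfolding yy[symmetric]
  proof (rule max)
    fix j assume "j < i"
    thus "ip (n1 + n2) y (c j) = 0" using w(2)[of j] by (simp only: y_def ip_sum_left mult.commute)
  qed
  finally show ?thesis using \<open>W > 0\<close> by simp
qed

text \<open>A nonzero \<open>y\<close> satisfies the \<open>i\<close> constraints and is also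
  orthogonal to the \<open>k\<close> most negative directions of \<epsilon> times the dilation,
  because \<open>i + k < n1 + n2\<close>. On such \<open>y\<close> the form is at least
  \<open>- t\<close> times the squared norm.\<close>

lemma eigenvalue_ge_minus:
  assumes max: "\<And>y. (\<And>j. j < i \<Longrightarrow> ip (n1 + n2) y (c j) = 0) \<Longrightarrow> q y \<le> \<mu> * ip (n1 + n2) y y"
    and dominates: "\<And>z. 2 * \<epsilon> * bil n1 n2 A z (\<lambda>l. z (n1 + l)) \<le> q z"
    and eps: "\<epsilon> * \<epsilon> = 1" and i: "i + k < n1 + n2" and k: "k \<le> n2"
    and small: "\<And>j. k \<le> j \<Longrightarrow> j < n2 \<Longrightarrow> s j \<le> t" and t: "t \<ge> 0"
  shows "- t \<le> \<mu>"
proof -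
  \<comment> \<open>\<open>g j\<close> is an eigenvector of \<epsilon> times the dilation with
    eigenvalue \<open>- s j\<close>; orthogonality to it gives the relation
    \<open>ab\<close>.\<close>
  define g where "g j = (\<lambda>a. if a < n1 then u j a else - \<epsilon> * v j (a - n1))" for j
  define h where "h l = (if l < i then c l else g (l - i))" for l
  obtain y where y: "\<exists>j<n1+n2. y j \<noteq> 0" "\<And>l. l < i + k \<Longrightarrow> ip (n1 + n2) (h l) y = 0"
    using underdetermined_nonzero_solution[OF i, of h] unfolding ip_def by blast
  have c0: "ip (n1 + n2) y (c j) = 0" if "j < i" for j
    using y(2)[of j] that by (simp add: h_def ip_commute)
  let ?a = "\<lambda>j. ip n1 (u j) y" and ?b = "\<lambda>j. ip n2 (v j) (\<lambda>l. y (n1 + l))"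
  have ab: "?a j = \<epsilon> * ?b j" if "j < k" for j
  proof -
    have "ip (n1 + n2) (g j) y = 0" using y(2)[of "i + j"] that by (simp add: h_def)
    moreover have "ip n1 (g j) y = ?a j" by (intro ip_cong) (auto simp: g_def)
    moreover have "ip n2 (\<lambda>l. g j (n1 + l)) (\<lambda>l. y (n1 + l)) = - \<epsilon> * ?b j"
      by (simp add: g_def ip_scaled_left[symmetric])
    ultimately show ?thesis unfolding ip_add_dim by simp
  qed
  \<comment> \<open>For \<open>j < k\<close> the relation \<open>ab\<close> makes the term a
    nonnegative multiple of a square; for the other \<open>j\<close> the bound
    \<open>s j \<le> t\<close> and AM-GM apply.\<close>
  have term_bound: "- (t / 2) * ((?a j)\<^sup>2 + (?b j)\<^sup>2) \<le> \<epsilon> * (s j * ?a j * ?b j)" if j: "j < n2" for j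
  proof (cases "j < k")
    case True
    have "\<epsilon> * (s j * ?a j * ?b j) = s j * (\<epsilon> * \<epsilon>) * (?b j)\<^sup>2"
      by (simp add: ab[OF True] power2_eq_square)
    also have "\<dots> \<ge> 0" using nonneg[OF j] eps by simp
    finally have "\<epsilon> * (s j * ?a j * ?b j) \<ge> 0" .
    moreover have "- (t / 2) * ((?a j)\<^sup>2 + (?b j)\<^sup>2) \<le> 0" using t by (simp add: mult_nonneg_nonneg)
    ultimately show ?thesis by linarith
  next
    case False
    have *: "- (((?a j)\<^sup>2 + (?b j)\<^sup>2) / 2) \<le> \<epsilon> * ?a j * ?b j" using eps by (rule signed_AM_GM)
    have "- (t / 2) * ((?a j)\<^sup>2 + (?b j)\<^sup>2) = t * - (((?a j)\<^sup>2 + (?b j)\<^sup>2) / 2)" by simp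
    also have "\<dots> \<le> s j * - (((?a j)\<^sup>2 + (?b j)\<^sup>2) / 2)"
      using small[of j] False j by (intro mult_right_mono_neg) auto
    also have "\<dots> \<le> s j * (\<epsilon> * ?a j * ?b j)"
      using * nonneg[OF j] by (rule mult_left_mono)
    finally show ?thesis by (simp add: ac_simps)
  qed
  have "- (t / 2) * ip (n1 + n2) y y \<le> - (t / 2) * ((\<Sum>j<n2. (?a j)\<^sup>2) + (\<Sum>j<n2. (?b j)\<^sup>2))"
    unfolding ip_add_dim using t
    by (intro mult_left_mono_neg add_mono Bessel_inequality semi_orthonormal_u semi_orthonormal_v) auto
  also have "\<dots> = (\<Sum>j<n2. - (t / 2) * ((?a j)\<^sup>2 + (?b j)\<^sup>2))"
    by (simp only: sum_distrib_left[symmetric] sum.distrib)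
  also have "\<dots> \<le> (\<Sum>j<n2. \<epsilon> * (s j * ?a j * ?b j))"
    using term_bound by (intro sum_mono) auto
  also have "\<dots> = \<epsilon> * bil n1 n2 A y (\<lambda>l. y (n1 + l))"
    by (simp add: bil_eq sum_distrib_left)
  finally have "- t * ip (n1 + n2) y y \<le> q y" using dominates[of y] by simp
  also have "\<dots> \<le> \<mu> * ip (n1 + n2) y y" using c0 by (rule max)
  finally have "- t * ip (n1 + n2) y y \<le> \<mu> * ip (n1 + n2) y y" .
  moreover have "ip (n1 + n2) y y > 0"
    using y(1) ip_self_nonneg[of "n1 + n2" y] ip_self_eq_0_iff[of "n1 + n2" y] by force
  ultimately show ?thesis by (meson mult_le_cancel_right_pos)
qed

end

section \<open>Perturbation by a low-rank matrix\<close>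

lemma ip_mv_eq_bil: "ip n x (mv n S y) = bil n n S x y"
  by (simp add: ip_def mv_def bil_def sum_distrib_left mult.assoc mult.left_commute)

lemma bil_add: "bil n1 n2 (\<lambda>i l. A i l + B i l) x y = bil n1 n2 A x y + bil n1 n2 B x y"
  by (simp add: bil_def sum.distrib algebra_simps)

lemma bil_cong:
  "(\<And>i l. i < n1 \<Longrightarrow> l < n2 \<Longrightarrow> A i l = B i l) \<Longrightarrow> bil n1 n2 A x y = bil n1 n2 B x y"
  by (simp add: bil_def)

definition dilation :: "nat \<Rightarrow> (nat \<Rightarrow> nat \<Rightarrow> real) \<Rightarrow> nat \<Rightarrow> nat \<Rightarrow> real" where
  "dilation n1 A i j = (if i < n1 then (if j < n1 then 0 else A i (j - n1))
     else (if j < n1 then A j (i - n1) else 0))"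

lemma bil_dilation:
  "bil (n1 + n2) (n1 + n2) (dilation n1 A) z z = 2 * bil n1 n2 A z (\<lambda>l. z (n1 + l))"
proof -
  have "bil (n1 + n2) (n1 + n2) (dilation n1 A) z z
      = (\<Sum>i<n1. \<Sum>l<n2. A i l * z i * z (n1 + l)) + (\<Sum>l<n2. \<Sum>i<n1. A i l * z (n1 + l) * z i)"
    by (simp add: bil_def dilation_def sum_lessThan_add)
  also have "(\<Sum>l<n2. \<Sum>i<n1. A i l * z (n1 + l) * z i) = (\<Sum>i<n1. \<Sum>l<n2. A i l * z i * z (n1 + l))"
    by (subst sum.swap) (simp add: ac_simps)
  finally show ?thesis by (simp add: bil_def)
qed

lemma (in eigen_system) sum_eigenvalues_eq_trace: "(\<Sum>k<n. d k) = (\<Sum>a<n. S a a)"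
proof -
  have "(\<Sum>a<n. S a a) = (\<Sum>a<n. \<Sum>k<n. d k * (v k a * v k a))"
    by (simp add: entry mult.assoc)
  also have "\<dots> = (\<Sum>k<n. d k * ip n (v k) (v k))"
    by (subst sum.swap) (simp add: ip_def sum_distrib_left)
  finally show ?thesis using orthonormal_v by (simp add: orthonormal_def)
qed

text \<open>The four blocks are the index ranges on which the eigenvalues get different lower
  bounds. The last block is counted from the far end, to match the singular values in decreasing
  order.\<close>

lemma sum_lessThan_split_ends:
  fixes g :: "nat \<Rightarrow> real"
  assumes "r \<le> M" "M + r \<le> N"
  shows "(\<Sum>i<N. g i) = (\<Sum>i<r. g i) + (\<Sum>i\<in>{r..<M}. g i) + (\<Sum>i\<in>{M..<N-r}. g i) + (\<Sum>i<r. g (N - 1 - i))"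
proof -
  have "(\<Sum>i<N. g i) = (\<Sum>i<N-r. g i) + (\<Sum>i<r. g (N - r + i))"
    using sum_lessThan_add[of g "N - r" r] assms by simp
  moreover have "(\<Sum>i<r. g (N - r + i)) = (\<Sum>i<r. g (N - 1 - i))"
    using assms by (subst sum.nat_diff_reindex[symmetric]) (intro sum.cong refl arg_cong[of _ _ g], auto)
  moreover have "(\<Sum>i<N-r. g i) = (\<Sum>i<r. g i) + (\<Sum>i\<in>{r..<M}. g i) + (\<Sum>i\<in>{M..<N-r}. g i)"
    unfolding lessThan_atLeast0 using assms by (simp add: sum.atLeastLessThan_concat)
  ultimately show ?thesis by simp
qed

text \<open>The eigenvalues of \<open>C\<close> are bounded below by \<open>s i\<close> for the
  first \<open>r\<close> indices, by \<open>t i\<close> up to \<open>min n1 n2\<close>, then by 0,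
  and by the values \<open>- t i\<close> for the last \<open>r\<close>.\<close>

theorem nuclear_perturbation_low_rank:
  assumes X: "svd_of n1 n2 X s u v" and H: "svd_of n1 n2 H t a b" and Y: "svd_of n1 n2 Y e p g"
    and add: "\<And>i l. i < n1 \<Longrightarrow> l < n2 \<Longrightarrow> Y i l = X i l + H i l"
    and rank: "\<And>j. r \<le> j \<Longrightarrow> j < n2 \<Longrightarrow> s j = 0" and r: "r \<le> n1" "r \<le> n2"
  shows "(\<Sum>j<r. s j) + (\<Sum>j\<in>{r..<min n1 n2}. t j) \<le> (\<Sum>j<n2. e j) + (\<Sum>j<r. t j)"
proof -
  interpret X: svd_of n1 n2 X s u v by (rule X)
  interpret H: svd_of n1 n2 H t a b by (rule H)
  interpret Y: svd_of n1 n2 Y e p g by (rule Y)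
  define N where "N = n1 + n2"
  \<comment> \<open>\<open>f k\<close> belongs to the eigenvalue \<open>- e k\<close> of the
    dilation of \<open>Y\<close> and has squared norm 2 when \<open>e k\<close> is nonzero; hence
    the weight \<open>e k / 2\<close> in the negative part \<open>P\<close>.\<close>
  define f where "f k = (\<lambda>i. if i < n1 then p k i else - g k (i - n1))" for k
  define P where "P i j = (\<Sum>k<n2. (e k / 2) * f k i * f k j)" for i j
  define C where "C i j = dilation n1 X i j + P i j" for i j
  define q where "q z = ip N z (mv N C z)" for z
  have bilY: "bil n1 n2 Y x y = bil n1 n2 X x y + bil n1 n2 H x y" for x y
    using bil_add[of n1 n2 X H x y] bil_cong[of n1 n2 Y "\<lambda>i l. X i l + H i l"] add by simp
  have ipf: "ip N (f k) z = ip n1 (p k) z - ip n2 (g k) (\<lambda>l. z (n1 + l))" for k z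
  proof -
    have "ip n1 (f k) z = ip n1 (p k) z" by (intro ip_cong) (auto simp: f_def)
    moreover have "ip n2 (\<lambda>l. f k (n1 + l)) (\<lambda>l. z (n1 + l)) = - ip n2 (g k) (\<lambda>l. z (n1 + l))"
      by (simp add: f_def ip_def sum_negf)
    ultimately show ?thesis by (simp add: N_def ip_add_dim)
  qed
  have q_eq: "q z = 2 * bil n1 n2 X z (\<lambda>l. z (n1 + l))
      + (\<Sum>k<n2. (e k / 2) * (ip n1 (p k) z - ip n2 (g k) (\<lambda>l. z (n1 + l)))\<^sup>2)" for z
  proof -
    have "q z = bil N N (dilation n1 X) z z + bil N N P z z"
      unfolding q_def ip_mv_eq_bil bil_add[symmetric] C_def ..
    also have "bil N N P z z = (\<Sum>k<n2. (e k / 2) * ip N (f k) z * ip N (f k) z)"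
      by (rule bil_rank_one_sum) (simp add: P_def)
    finally show ?thesis
      unfolding N_def bil_dilation ipf[unfolded N_def] by (simp add: power2_eq_square mult.assoc)
  qed
  have domX: "2 * 1 * bil n1 n2 X z (\<lambda>l. z (n1 + l)) \<le> q z" for z
  proof -
    have "0 \<le> (\<Sum>k<n2. (e k / 2) * (ip n1 (p k) z - ip n2 (g k) (\<lambda>l. z (n1 + l)))\<^sup>2)"
      by (intro sum_nonneg mult_nonneg_nonneg) (auto simp: Y.nonneg)
    thus ?thesis unfolding q_eq by simp
  qed
  \<comment> \<open>\<open>C\<close> plus the dilation of \<open>H\<close> is the dilation of
    \<open>Y\<close> plus its negative part, that is, its positive part: a weighted sum of
    squares.\<close>
  have domH: "2 * (-1) * bil n1 n2 H z (\<lambda>l. z (n1 + l)) \<le> q z" for z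
  proof -
    let ?\<alpha> = "\<lambda>k. ip n1 (p k) z" and ?\<beta> = "\<lambda>k. ip n2 (g k) (\<lambda>l. z (n1 + l))"
    have "2 * bil n1 n2 Y z (\<lambda>l. z (n1 + l)) + (\<Sum>k<n2. (e k / 2) * (?\<alpha> k - ?\<beta> k)\<^sup>2)
        = (\<Sum>k<n2. (e k / 2) * (?\<alpha> k + ?\<beta> k)\<^sup>2)"
      unfolding Y.bil_eq sum_distrib_left sum.distrib[symmetric]
      by (intro sum.cong refl) (simp add: power2_eq_square field_simps)
    also have "\<dots> \<ge> 0" by (intro sum_nonneg mult_nonneg_nonneg) (auto simp: Y.nonneg)
    finally show ?thesis unfolding q_eq using bilY[of z "\<lambda>l. z (n1 + l)"] by simp
  qed
  have sym: "C i j = C j i" for i j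
    by (simp add: C_def P_def dilation_def ac_simps)
  obtain \<mu> c where "eigen_system N C \<mu> c" using spectral_decomposition[of N C] sym by blast
  then interpret C: eigen_system N C \<mu> c .
  note max = C.Rayleigh_le[folded q_def]
  \<comment> \<open>The dilation has zero diagonal, so only \<open>P\<close> contributes to the
    trace.\<close>
  have "(\<Sum>k<N. \<mu> k) = (\<Sum>i<N. C i i)"
    by (rule C.sum_eigenvalues_eq_trace)
  also have "\<dots> = (\<Sum>i<N. \<Sum>k<n2. (e k / 2) * (f k i * f k i))"
    by (simp add: C_def P_def dilation_def mult.assoc)
  also have "\<dots> = (\<Sum>k<n2. (e k / 2) * ip N (f k) (f k))"
    by (subst sum.swap) (simp add: ip_def sum_distrib_left)
  also have "\<dots> = (\<Sum>k<n2. e k)"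
  proof (intro sum.cong refl)
    fix k assume k: "k \<in> {..<n2}"
    have "ip n1 (p k) (f k) = ip n1 (p k) (p k)" by (intro ip_cong) (auto simp: f_def)
    moreover have "ip n2 (g k) (\<lambda>l. f k (n1 + l)) = - ip n2 (g k) (g k)"
      by (simp add: f_def ip_def sum_negf)
    ultimately show "(e k / 2) * ip N (f k) (f k) = e k"
      unfolding ipf using k by (auto simp: Y.ip_u Y.ip_v)
  qed
  finally have trace: "(\<Sum>k<N. \<mu> k) = (\<Sum>k<n2. e k)" .
  \<comment> \<open>The dilation of \<open>X\<close> has at most \<open>r\<close> negative
    eigenvalues, so removing \<open>k = r\<close> directions allows the bound 0.\<close>
  have nonneg: "0 \<le> \<mu> i" if "i + r < N" for i
  proof -
    have "- 0 \<le> \<mu> i"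
      using that r rank unfolding N_def
      by (intro X.eigenvalue_ge_minus[where k = r and c = c and q = q and i = i and \<epsilon> = 1]
          max[unfolded N_def] domX) auto
    thus ?thesis by simp
  qed
  have top_X: "s i \<le> \<mu> i" if "i < r" for i
  proof (cases "s i > 0")
    case True
    show ?thesis
      using that r True
      by (intro X.sing_le_eigenvalue[where c = c and q = q and i = i and \<epsilon> = 1]
          max[unfolded N_def] domX) auto
  next
    case False
    thus ?thesis using nonneg[of i] that r by (simp add: N_def)
  qed
  have mid_H: "t i \<le> \<mu> i" if "r \<le> i" "i < min n1 n2" for i
  proof (cases "t i > 0")
    case True
    show ?thesis
      using that True
      by (intro H.sing_le_eigenvalue[where c = c and q = q and i = i and \<epsilon> = "-1"]
          max[unfolded N_def] domH) auto
  next
    case False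
    thus ?thesis using nonneg[of i] that r by (simp add: N_def)
  qed
  \<comment> \<open>With \<open>k = i\<close> the indices just fit:
    \<open>(N - 1 - i) + i < N\<close>, and every remaining singular value of \<open>H\<close> is at
    most \<open>t i\<close>.\<close>
  have bot_H: "- t i \<le> \<mu> (N - 1 - i)" if "i < r" for i
    using that r H.nonneg[of i] H.decreasing
    by (intro H.eigenvalue_ge_minus[where k = i and c = c and q = q and i = "N - 1 - i" and \<epsilon> = "-1"]
        max[unfolded N_def] domH) (auto simp: N_def)
  have "(\<Sum>i<r. s i) \<le> (\<Sum>i<r. \<mu> i)" using top_X by (intro sum_mono) auto
  moreover have "(\<Sum>i\<in>{r..<min n1 n2}. t i) \<le> (\<Sum>i\<in>{r..<min n1 n2}. \<mu> i)"
    using mid_H by (intro sum_mono) auto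
  moreover have "0 \<le> (\<Sum>i\<in>{min n1 n2..<N-r}. \<mu> i)" using nonneg by (intro sum_nonneg) auto
  moreover have "- (\<Sum>i<r. t i) \<le> (\<Sum>i<r. \<mu> (N - 1 - i))"
    unfolding sum_negf[symmetric] using bot_H by (intro sum_mono) auto
  moreover have "(\<Sum>k<N. \<mu> k) = (\<Sum>i<r. \<mu> i) + (\<Sum>i\<in>{r..<min n1 n2}. \<mu> i)
      + (\<Sum>i\<in>{min n1 n2..<N-r}. \<mu> i) + (\<Sum>i<r. \<mu> (N - 1 - i))"
    by (rule sum_lessThan_split_ends) (use r in \<open>auto simp: N_def\<close>)
  ultimately show ?thesis using trace by linarith
qed

section \<open>Von Neumann's trace inequality with a low-rank factor\<close>

text \<open>Weights in \<open>[0, 1]\<close> of total at most \<open>r\<close> do best on the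
  \<open>r\<close> largest terms. Comparing every \<open>t j\<close> with the threshold
  \<open>t r\<close> proves it.\<close>

lemma weighted_sum_le_top_sum:
  fixes t w :: "nat \<Rightarrow> real"
  assumes dec: "\<And>i j. i \<le> j \<Longrightarrow> j < n \<Longrightarrow> t j \<le> t i" and nonneg: "\<And>j. j < n \<Longrightarrow> 0 \<le> t j"
    and w: "\<And>j. j < n \<Longrightarrow> 0 \<le> w j" "\<And>j. j < n \<Longrightarrow> w j \<le> 1" and sum_w: "(\<Sum>j<n. w j) \<le> real r"
    and r: "r \<le> n"
  shows "(\<Sum>j<n. t j * w j) \<le> (\<Sum>j<r. t j)"
proof (cases "r = n")
  case True
  thus ?thesis using nonneg w by (auto intro!: sum_mono mult_left_le)
next
  case False
  hence rn: "r < n" using r by simp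
  have split: "(\<Sum>j<n. h j) = (\<Sum>j<r. h j) + (\<Sum>j\<in>{r..<n}. h j)" for h :: "nat \<Rightarrow> real"
    unfolding lessThan_atLeast0 using r by (simp add: sum.atLeastLessThan_concat)
  have "(\<Sum>j<r. t j * (w j - 1)) \<le> (\<Sum>j<r. t r * (w j - 1))"
    using dec w rn by (intro sum_mono mult_right_mono_neg) auto
  moreover have "(\<Sum>j\<in>{r..<n}. t j * w j) \<le> (\<Sum>j\<in>{r..<n}. t r * w j)"
    using dec w rn by (intro sum_mono mult_right_mono) auto
  ultimately have "(\<Sum>j<n. t j * w j) - (\<Sum>j<r. t j)
      \<le> t r * ((\<Sum>j<r. w j) - real r) + t r * (\<Sum>j\<in>{r..<n}. w j)"
    unfolding split by (simp add: sum_subtractf sum_distrib_left right_diff_distrib mult.commute[of "real r"])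
  also have "\<dots> = t r * ((\<Sum>j<n. w j) - real r)" unfolding split by (simp add: algebra_simps)
  also have "\<dots> \<le> 0" using sum_w nonneg[OF rn] by (simp add: mult_nonneg_nonpos)
  finally show ?thesis by simp
qed

definition fro_ip :: "nat \<Rightarrow> nat \<Rightarrow> (nat \<Rightarrow> nat \<Rightarrow> real) \<Rightarrow> (nat \<Rightarrow> nat \<Rightarrow> real) \<Rightarrow> real" where
  "fro_ip n1 n2 A B = (\<Sum>i<n1. \<Sum>l<n2. A i l * B i l)"

lemma (in svd_of) fro_ip_eq_sum_bil: "fro_ip n1 n2 A B = (\<Sum>k<n2. s k * bil n1 n2 B (u k) (v k))"
proof -
  have "fro_ip n1 n2 A B = (\<Sum>i<n1. \<Sum>l<n2. \<Sum>k<n2. s k * (B i l * u k i * v k l))"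
    unfolding fro_ip_def by (intro sum.cong refl) (simp add: entry sum_distrib_left sum_distrib_right ac_simps)
  also have "\<dots> = (\<Sum>i<n1. \<Sum>k<n2. \<Sum>l<n2. s k * (B i l * u k i * v k l))"
    by (intro sum.cong refl sum.swap)
  also have "\<dots> = (\<Sum>k<n2. \<Sum>i<n1. \<Sum>l<n2. s k * (B i l * u k i * v k l))"
    by (rule sum.swap)
  finally show ?thesis by (simp add: bil_def sum_distrib_left)
qed

lemma (in svd_of) fro_ip_self: "fro_ip n1 n2 A A = (\<Sum>k<n2. (s k)\<^sup>2)"
proof -
  have "bil n1 n2 A (u k) (v k) = s k" if "k < n2" for k
  proof -
    have "bil n1 n2 A (u k) (v k) = (\<Sum>j<n2. if j = k then s k else 0)"
      unfolding bil_eq using that by (intro sum.cong refl) (auto simp: ip_u ip_v)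
    thus ?thesis using that by simp
  qed
  thus ?thesis by (simp add: fro_ip_eq_sum_bil power2_eq_square)
qed

text \<open>Expanding both matrices in singular vectors gives products of two coefficients, which
  AM-GM bounds by means of squares. Summed over \<open>k\<close>, these means are weights
  \<open>w j\<close>; by Bessel's inequality each is at most 1 and their total is at most
  \<open>r\<close>.\<close>

theorem von_Neumann_low_rank:
  assumes X: "svd_of n1 n2 X s u v" and H: "svd_of n1 n2 H t a b"
    and c: "\<And>j. j < n2 \<Longrightarrow> s j \<le> c" "c \<ge> 0"
    and rank: "\<And>j. r \<le> j \<Longrightarrow> j < n2 \<Longrightarrow> s j = 0" and r: "r \<le> n2"
  shows "- (c * (\<Sum>j<r. t j)) \<le> fro_ip n1 n2 X H"
proof -
  interpret X: svd_of n1 n2 X s u v by (rule X)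
  interpret H: svd_of n1 n2 H t a b by (rule H)
  let ?\<alpha> = "\<lambda>k j. ip n1 (u k) (a j)" and ?\<beta> = "\<lambda>k j. ip n2 (v k) (b j)"
  define w where "w j = (\<Sum>k<r. ((?\<alpha> k j)\<^sup>2 + (?\<beta> k j)\<^sup>2) / 2)" for j
  have w_eq: "w j = ((\<Sum>k<r. (?\<alpha> k j)\<^sup>2) + (\<Sum>k<r. (?\<beta> k j)\<^sup>2)) / 2" for j
    by (simp add: w_def sum.distrib sum_divide_distrib[symmetric])
  have w1: "w j \<le> 1" if "j < n2" for j
  proof -
    have "(\<Sum>k<r. (?\<alpha> k j)\<^sup>2) \<le> ip n1 (a j) (a j)"
      by (rule Bessel_inequality[OF semi_orthonormal_mono[OF X.semi_orthonormal_u r]])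
    moreover have "(\<Sum>k<r. (?\<beta> k j)\<^sup>2) \<le> ip n2 (b j) (b j)"
      by (rule Bessel_inequality[OF semi_orthonormal_mono[OF X.semi_orthonormal_v r]])
    moreover have "ip n1 (a j) (a j) \<le> 1" "ip n2 (b j) (b j) = 1"
      using that by (auto simp: H.ip_u H.ip_v)
    ultimately show ?thesis by (simp add: w_eq)
  qed
  have w_sum: "(\<Sum>j<n2. w j) \<le> real r"
  proof -
    have "(\<Sum>j<n2. w j) = (\<Sum>k<r. \<Sum>j<n2. ((?\<alpha> k j)\<^sup>2 + (?\<beta> k j)\<^sup>2) / 2)"
      unfolding w_def by (rule sum.swap)
    also have "\<dots> = (\<Sum>k<r. ((\<Sum>j<n2. (?\<alpha> k j)\<^sup>2) + (\<Sum>j<n2. (?\<beta> k j)\<^sup>2)) / 2)"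
      by (simp add: sum.distrib sum_divide_distrib[symmetric])
    also have "\<dots> \<le> (\<Sum>k<r. 1)"
    proof (rule sum_mono)
      fix k assume "k \<in> {..<r}"
      hence k: "k < n2" using r by simp
      have "(\<Sum>j<n2. (?\<alpha> k j)\<^sup>2) \<le> ip n1 (u k) (u k)"
        using Bessel_inequality[OF H.semi_orthonormal_u, of "u k"] by (simp add: ip_commute)
      moreover have "(\<Sum>j<n2. (?\<beta> k j)\<^sup>2) \<le> ip n2 (v k) (v k)"
        using Bessel_inequality[OF H.semi_orthonormal_v, of "v k"] by (simp add: ip_commute)
      moreover have "ip n1 (u k) (u k) \<le> 1" "ip n2 (v k) (v k) = 1"
        using k by (auto simp: X.ip_u X.ip_v)
      ultimately show "((\<Sum>j<n2. (?\<alpha> k j)\<^sup>2) + (\<Sum>j<n2. (?\<beta> k j)\<^sup>2)) / 2 \<le> 1" by simp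
    qed
    finally show ?thesis by simp
  qed
  have term_bound: "- (c * (t j * (((?\<alpha> k j)\<^sup>2 + (?\<beta> k j)\<^sup>2) / 2))) \<le> s k * (t j * ?\<alpha> k j * ?\<beta> k j)"
    if "k < r" "j < n2" for k j
  proof -
    let ?D = "((?\<alpha> k j)\<^sup>2 + (?\<beta> k j)\<^sup>2) / 2"
    have k: "k < n2" using that r by simp
    have "- (c * (t j * ?D)) = c * (- (t j * ?D))" by simp
    also have "\<dots> \<le> s k * (- (t j * ?D))"
      using c(1)[OF k] H.nonneg[OF that(2)] by (intro mult_right_mono_neg) auto
    also have "\<dots> = s k * (t j * - ?D)" by simp
    also have "\<dots> \<le> s k * (t j * (1 * ?\<alpha> k j * ?\<beta> k j))"
      using X.nonneg[OF k] H.nonneg[OF that(2)] by (intro mult_left_mono signed_AM_GM) auto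
    finally show ?thesis by (simp add: mult.assoc)
  qed
  have "(\<Sum>j<n2. t j * w j) \<le> (\<Sum>j<r. t j)"
    using w1 w_sum r H.decreasing H.nonneg
    by (intro weighted_sum_le_top_sum) (auto simp: w_def intro!: sum_nonneg)
  hence "- (c * (\<Sum>j<r. t j)) \<le> - (c * (\<Sum>j<n2. t j * w j))"
    using c(2) by (simp add: mult_left_mono)
  also have "\<dots> = (\<Sum>j<n2. \<Sum>k<r. - (c * (t j * (((?\<alpha> k j)\<^sup>2 + (?\<beta> k j)\<^sup>2) / 2))))"
    by (simp only: w_def sum_distrib_left sum_negf)
  also have "\<dots> \<le> (\<Sum>j<n2. \<Sum>k<r. s k * (t j * ?\<alpha> k j * ?\<beta> k j))"
    using term_bound by (intro sum_mono) auto
  also have "\<dots> = (\<Sum>k<r. s k * bil n1 n2 H (u k) (v k))"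
    by (subst sum.swap) (simp add: H.bil_eq sum_distrib_left ip_commute)
  also have "\<dots> = (\<Sum>k<n2. s k * bil n1 n2 H (u k) (v k))"
    using r rank by (intro sum.mono_neutral_left) auto
  also have "\<dots> = fro_ip n1 n2 X H" by (rule X.fro_ip_eq_sum_bil[symmetric])
  finally show ?thesis .
qed

section \<open>Singular values and rank of matrices\<close>

text \<open>The orthogonal matrix of eigenvectors makes \<open>M\<close> similar to a diagonal
  matrix. This identifies the roots used in \<open>sing_vals\<close>, with multiplicity, as the
  numbers \<open>d\<close>.\<close>

lemma char_poly_eigen_system:
  assumes "eigen_system n (\<lambda>i j. M $$ (i, j)) d v" and M: "M \<in> carrier_mat n n"
  shows "char_poly M = (\<Prod>e\<leftarrow>map d [0..<n]. [:- e, 1:])"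
proof -
  interpret eigen_system n "\<lambda>i j. M $$ (i, j)" d v by (rule assms)
  define Q where "Q = mat n n (\<lambda>(i, k). v k i)"
  define E where "E = mat n n (\<lambda>(i, k). if i = k then d i else 0)"
  have car: "Q \<in> carrier_mat n n" "transpose_mat Q \<in> carrier_mat n n" "E \<in> carrier_mat n n"
    by (auto simp: Q_def E_def)
  have QQ: "transpose_mat Q * Q = 1\<^sub>m n"
    using orthonormal_v
    by (intro eq_matI) (auto simp: Q_def orthonormal_def ip_def scalar_prod_def lessThan_atLeast0)
  have "M = Q * E * transpose_mat Q"
  proof (rule eq_matI)
    fix i j assume "i < dim_row (Q * E * transpose_mat Q)" "j < dim_col (Q * E * transpose_mat Q)"
    hence ij: "i < n" "j < n" by (auto simp: Q_def)
    have QE: "(Q * E) $$ (i, k) = d k * v k i" if "k < n" for k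
    proof -
      have "(Q * E) $$ (i, k) = (\<Sum>l<n. v l i * (if l = k then d l else 0))"
        using ij that by (simp add: Q_def E_def scalar_prod_def lessThan_atLeast0)
      also have "\<dots> = (\<Sum>l<n. if l = k then d k * v k i else 0)" by (intro sum.cong) auto
      finally show ?thesis using that by simp
    qed
    have "(Q * E * transpose_mat Q) $$ (i, j) = (\<Sum>k<n. (Q * E) $$ (i, k) * v k j)"
      using ij by (simp add: Q_def E_def scalar_prod_def lessThan_atLeast0)
    thus "M $$ (i, j) = (Q * E * transpose_mat Q) $$ (i, j)"
      using ij by (simp add: QE entry)
  qed (use M in \<open>auto simp: Q_def\<close>)
  hence "similar_mat_wit M E Q (transpose_mat Q)"
    using car M QQ mat_mult_left_right_inverse[OF car(2,1) QQ]
    by (auto simp: similar_mat_wit_def Let_def)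
  hence "char_poly M = char_poly E" by (intro char_poly_similar) (auto simp: similar_mat_def)
  also have "\<dots> = (\<Prod>e\<leftarrow>diag_mat E. [:- e, 1:])"
    by (rule char_poly_upper_triangular[OF car(3)]) (auto simp: E_def)
  also have "diag_mat E = map d [0..<n]" by (auto simp: diag_mat_def E_def)
  finally show ?thesis .
qed

lemma proots_prod_linear_factors: "proots (\<Prod>e\<leftarrow>es. [:- e, 1:]) = mset (es :: real list)"
proof (induction es)
  case (Cons e es)
  have "(\<Prod>e\<leftarrow>es. [:- e, 1:]) \<noteq> (0 :: real poly)" by (auto simp: prod_list_zero_iff)
  thus ?case using Cons by (simp add: proots_mult del: mult_pCons_left)
qed simp

lemma rev_sorted_list_of_decreasing:
  fixes xs :: "real list"
  assumes "sorted (rev xs)"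
  shows "rev (sorted_list_of_multiset (mset xs)) = xs"
proof -
  have "sorted_list_of_multiset (mset xs) = sort xs" by simp
  also have "sort xs = rev xs" by (rule properties_for_sort) (use assms in auto)
  finally show ?thesis by simp
qed

lemma Gram_ip:
  "ip n1 (\<lambda>k. \<Sum>l<n2. A k l * x l) (\<lambda>k. \<Sum>l<n2. A k l * y l)
     = ip n2 x (mv n2 (\<lambda>i j. \<Sum>k<n1. A k i * A k j) y)"
proof -
  have "ip n1 (\<lambda>k. \<Sum>l<n2. A k l * x l) (\<lambda>k. \<Sum>l<n2. A k l * y l)
      = (\<Sum>k<n1. \<Sum>i<n2. \<Sum>j<n2. A k i * x i * (A k j * y j))"
    by (simp add: ip_def sum_product)
  also have "\<dots> = (\<Sum>i<n2. \<Sum>k<n1. \<Sum>j<n2. A k i * x i * (A k j * y j))" by (rule sum.swap)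
  also have "\<dots> = (\<Sum>i<n2. \<Sum>j<n2. \<Sum>k<n1. A k i * x i * (A k j * y j))"
    by (intro sum.cong refl sum.swap)
  also have "\<dots> = ip n2 x (mv n2 (\<lambda>i j. \<Sum>k<n1. A k i * A k j) y)"
    by (simp add: ip_def mv_def sum_distrib_left sum_distrib_right ac_simps)
  finally show ?thesis .
qed

text \<open>The right singular vectors are eigenvectors of the Gram matrix. Their images under
  \<open>A\<close> are orthogonal with squared norms \<open>d j\<close>, and rescaling them gives
  the left ones. \<open>Suc j\<close> appears because \<open>sigma\<close> counts from 1.\<close>

theorem svd_exists:
  assumes A: "A \<in> carrier_mat n1 n2"
  shows "length (sing_vals A) = n2" (is ?len)
    and "\<exists>u v. svd_of n1 n2 (\<lambda>i l. A $$ (i, l)) (\<lambda>j. sigma A (Suc j)) u v" (is ?svd)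
proof -
  define M where "M = transpose_mat A * A"
  have M: "M \<in> carrier_mat n2 n2" using A by (simp add: M_def)
  have M_entry: "M $$ (i, j) = (\<Sum>k<n1. A $$ (k, i) * A $$ (k, j))" if "i < n2" "j < n2" for i j
    using that A by (simp add: M_def scalar_prod_def lessThan_atLeast0)
  obtain d v where es: "eigen_system n2 (\<lambda>i j. M $$ (i, j)) d v"
    using spectral_decomposition[of n2 "\<lambda>i j. M $$ (i, j)"] M_entry by (auto simp: mult.commute)
  interpret E: eigen_system n2 "\<lambda>i j. M $$ (i, j)" d v by (rule es)
  have ip_v: "ip n2 (v i) (v j) = (if i = j then 1 else 0)" if "i < n2" "j < n2" for i j
    using E.orthonormal_v that by (simp add: orthonormal_def)
  define h where "h j k = (\<Sum>l<n2. A $$ (k, l) * v j l)" for j k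
  have ip_h: "ip n1 (h i) (h j) = (if i = j then d j else 0)" if ij: "i < n2" "j < n2" for i j
  proof -
    have "ip n1 (h i) (h j) = ip n2 (v i) (mv n2 (\<lambda>i j. \<Sum>k<n1. A $$ (k, i) * A $$ (k, j)) (v j))"
      unfolding h_def by (rule Gram_ip)
    also have "\<dots> = ip n2 (v i) (\<lambda>a. d j * v j a)"
      using E.eigenvector[OF ij(2)] by (intro ip_cong) (auto simp: mv_def M_entry)
    finally show ?thesis using ip_v[OF ij] by (simp add: ip_scaled_right)
  qed
  have d_nonneg: "d j \<ge> 0" if "j < n2" for j
    using ip_h[OF that that] ip_self_nonneg[of n1 "h j"] by simp
  have "sing_vals A = map (\<lambda>j. sqrt (d j)) [0..<n2]"
  proof -
    have "image_mset sqrt (proots (char_poly M)) = mset (map (\<lambda>j. sqrt (d j)) [0..<n2])"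
      unfolding char_poly_eigen_system[OF es M] proots_prod_linear_factors by (simp add: multiset.map_comp comp_def)
    moreover have "sorted (rev (map (\<lambda>j. sqrt (d j)) [0..<n2]))"
      using E.decreasing by (auto simp: sorted_wrt_iff_nth_less rev_nth)
    ultimately show ?thesis
      unfolding sing_vals_def M_def[symmetric] by (metis rev_sorted_list_of_decreasing)
  qed
  thus ?len by simp
  have sigma: "sigma A (Suc j) = sqrt (d j)" if "j < n2" for j
    using that \<open>sing_vals A = _\<close> by (simp add: sigma_def)
  \<comment> \<open>Division by 0 yields 0, so \<open>u j\<close> is the zero vector when
    \<open>d j = 0\<close>, as \<open>svd_of\<close> demands.\<close>
  define u where "u j k = h j k / sqrt (d j)" for j k
  have h_eq: "h j k = sqrt (d j) * u j k" if "j < n2" "k < n1" for j k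
  proof (cases "d j = 0")
    case True
    hence "h j k = 0" using ip_h[OF that(1) that(1)] that(2) ip_self_eq_0_iff[of n1 "h j"] by simp
    thus ?thesis using True by simp
  qed (simp add: u_def)
  have "svd_of n1 n2 (\<lambda>i l. A $$ (i, l)) (\<lambda>j. sigma A (Suc j)) u v"
  proof
    fix i l assume il: "i < n1" "l < n2"
    have "(\<Sum>k<n2. sigma A (Suc k) * u k i * v k l) = (\<Sum>k<n2. h k i * v k l)"
      using il by (simp add: sigma h_eq)
    also have "\<dots> = (\<Sum>k<n2. \<Sum>j<n2. A $$ (i, j) * (v k j * v k l))"
      by (simp add: h_def sum_distrib_right mult.assoc)
    also have "\<dots> = (\<Sum>j<n2. A $$ (i, j) * (\<Sum>k<n2. v k j * v k l))"
      by (subst sum.swap) (simp add: sum_distrib_left)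
    also have "\<dots> = (\<Sum>j<n2. if j = l then A $$ (i, j) else 0)"
      using il orthonormal_complete[OF E.orthonormal_v] by (intro sum.cong) auto
    also have "\<dots> = A $$ (i, l)" using il by simp
    finally show "A $$ (i, l) = (\<Sum>k<n2. sigma A (Suc k) * u k i * v k l)" by simp
  next
    fix i j assume "i \<le> j" "j < n2"
    thus "sigma A (Suc j) \<le> sigma A (Suc i)" using E.decreasing by (simp add: sigma)
  next
    fix j assume "j < n2"
    thus "0 \<le> sigma A (Suc j)" using d_nonneg by (simp add: sigma)
  next
    show "orthonormal n2 n2 v" by (rule E.orthonormal_v)
  next
    fix i j assume ij: "i < n2" "j < n2"
    have "ip n1 (u i) (u j) = ip n1 (h i) (h j) / (sqrt (d i) * sqrt (d j))"
      unfolding u_def ip_def by (simp add: sum_divide_distrib)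
    thus "ip n1 (u i) (u j) = (if i = j \<and> sigma A (Suc i) \<noteq> 0 then 1 else 0)"
      using ij d_nonneg[OF ij(1)] by (auto simp: ip_h sigma)
  qed
  thus ?svd by blast
qed

section \<open>Rank and vanishing singular values\<close>

text \<open>If \<open>s j\<close> were nonzero, the \<open>j + 1 > r\<close> orthonormal vectors
  \<open>u 0\<close>, ..., \<open>u j\<close> would lie in the span of the \<open>r\<close> columns
  of \<open>F\<close>, hence be linearly dependent.\<close>

lemma (in svd_of) sing_eq_0_of_factorization:
  assumes fac: "\<And>i l. i < n1 \<Longrightarrow> l < n2 \<Longrightarrow> A i l = (\<Sum>t<r. F i t * G t l)"
    and j: "r \<le> j" "j < n2"
  shows "s j = 0"
proof (rule ccontr)
  assume "s j \<noteq> 0"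
  have s0: "s k \<noteq> 0" if "k < Suc j" for k
    using decreasing[of k j] nonneg[of j] \<open>s j \<noteq> 0\<close> that j by force
  have sub: "{..<Suc j} \<subseteq> {..<n2}" using j by auto
  obtain w where w: "\<exists>k<Suc j. w k \<noteq> 0"
    "\<And>t. t < r \<Longrightarrow> (\<Sum>k<Suc j. ip n2 (G t) (v k) / s k * w k) = 0"
    using underdetermined_nonzero_solution[of r "Suc j" "\<lambda>t k. ip n2 (G t) (v k) / s k"] j by auto
  have u_eq: "u k i = (\<Sum>t<r. F i t * (ip n2 (G t) (v k) / s k))" if "i < n1" "k < Suc j" for i k
  proof -
    have "(\<Sum>l<n2. A i l * v k l) = ip n2 (\<lambda>l. \<Sum>m<n2. (s m * u m i) * v m l) (v k)"
      unfolding ip_def using that by (intro sum.cong) (auto simp: entry)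
    also have "\<dots> = s k * u k i"
      using that j by (subst ip_sum_semi_orthonormal[OF semi_orthonormal_v]) (auto simp: ip_v)
    finally have "s k * u k i = (\<Sum>l<n2. A i l * v k l)" by simp
    also have "\<dots> = ip n2 (\<lambda>l. \<Sum>t<r. F i t * G t l) (v k)"
      unfolding ip_def using that by (intro sum.cong) (auto simp: fac)
    also have "\<dots> = (\<Sum>t<r. F i t * ip n2 (G t) (v k))" by (rule ip_sum_left)
    finally have "u k i = (\<Sum>t<r. F i t * ip n2 (G t) (v k)) / s k"
      using s0[OF that(2)] by (simp add: field_simps)
    thus ?thesis by (simp add: sum_divide_distrib)
  qed
  define x where "x = (\<lambda>i. \<Sum>k<Suc j. w k * u k i)"
  have "x i = 0" if "i < n1" for i
  proof -
    have "x i = (\<Sum>k<Suc j. \<Sum>t<r. F i t * (ip n2 (G t) (v k) / s k * w k))"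
      unfolding x_def using that
      by (intro sum.cong refl) (simp add: u_eq sum_distrib_left ac_simps)
    also have "\<dots> = (\<Sum>t<r. F i t * (\<Sum>k<Suc j. ip n2 (G t) (v k) / s k * w k))"
      by (subst sum.swap) (simp only: sum_distrib_left)
    also have "\<dots> = 0" using w(2) by (intro sum.neutral) simp
    finally show ?thesis .
  qed
  hence "ip n1 x x = 0" by (simp add: ip_self_eq_0_iff)
  moreover have "ip n1 x x = (\<Sum>k<Suc j. (w k)\<^sup>2)"
    unfolding x_def ip_sum_self_semi_orthonormal[OF semi_orthonormal_u sub]
    using sub s0 by (intro sum.cong refl) (auto simp: ip_u)
  ultimately show False
    using w(1) by (auto simp: sum_nonneg_eq_0_iff simp del: sum.lessThan_Suc)
qed

text \<open>A maximal independent set of columns has \<open>mat_rank A\<close> elements and spans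
  all columns. These columns form \<open>F\<close>, and the coefficients form
  \<open>G\<close>.\<close>

lemma rank_factorization:
  fixes A :: "real mat"
  assumes A: "A \<in> carrier_mat n nc"
  obtains F G where "\<And>i l. i < n \<Longrightarrow> l < nc \<Longrightarrow> A $$ (i, l) = (\<Sum>t<mat_rank A. F i t * G t l)"
proof -
  interpret vec_space "TYPE(real)" n .
  have cols: "set (cols A) \<subseteq> carrier_vec n" using A cols_dim by blast
  obtain S where S: "finite S" "maximal S (\<lambda>T. T \<subseteq> set (cols A) \<and> lin_indpt T)"
    using maximal_exists_superset[of "set (cols A)" "\<lambda>T. T \<subseteq> set (cols A) \<and> lin_indpt T" "{}"]
      finite_lin_indpt2[of "{}"] by auto
  have S_sub: "S \<subseteq> set (cols A)" and S_ind: "lin_indpt S" using S(2) by (auto simp: maximal_def)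
  have S_car: "S \<subseteq> carrier_vec n" using S_sub cols by blast
  have rank: "mat_rank A = card S"
    using rank_card_indpt[OF A S(2)] A by (simp add: mat_rank_def)
  have in_span: "x \<in> span S" if "x \<in> set (cols A)" for x
  proof (cases "x \<in> S")
    case True
    thus ?thesis using span_mem S_car by blast
  next
    case False
    hence "lin_dep (insert x S)"
      using S(2) S_sub that unfolding maximal_def by blast
    thus ?thesis using lin_dep_iff_in_span[OF S_car S_ind _ False] that cols by auto
  qed
  obtain bs where bs: "set bs = S" "distinct bs" using finite_distinct_list[OF S(1)] by blast
  define B where "B = mat_of_cols n bs"
  have colsB: "cols B = bs" unfolding B_def using bs(1) S_car by (intro cols_mat_of_cols) auto
  have B: "B \<in> carrier_mat n (length bs)" by (simp add: B_def)
  have "\<exists>a. col A l = lincomb a S" if "l < nc" for l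
  proof -
    have "col A l \<in> span S" using in_span[of "col A l"] A that by (auto simp: cols_def)
    thus ?thesis using finite_in_span[OF S(1) S_car] by metis
  qed
  then obtain a where a: "\<And>l. l < nc \<Longrightarrow> col A l = lincomb (a l) S" by metis
  show thesis
  proof (rule that)
    fix i l assume il: "i < n" "l < nc"
    have "A $$ (i, l) = col A l $ i" using il A by simp
    also have "col A l = B *\<^sub>v vec (length bs) (\<lambda>t. a l (col B t))"
      using mat_mult_eq_lincomb[OF B, of "a l"] a[OF il(2)] by (simp add: colsB bs)
    also have "\<dots> $ i = (\<Sum>t<length bs. B $$ (i, t) * a l (col B t))"
      using il B by (simp add: scalar_prod_def lessThan_atLeast0)
    finally show "A $$ (i, l) = (\<Sum>t<mat_rank A. B $$ (i, t) * a l (col B t))"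
      using bs distinct_card rank by metis
  qed
qed

section \<open>Recovery by the regularized nuclear norm\<close>

lemma nuc_norm_eq_sum:
  assumes "A \<in> carrier_mat n1 n2"
  shows "nuc_norm A = (\<Sum>j<n2. sigma A (Suc j))"
  unfolding nuc_norm_def sum_list_sum_nth svd_exists(1)[OF assms]
  by (simp add: sigma_def svd_exists(1)[OF assms] lessThan_atLeast0)

lemma fro_norm_square:
  assumes "A \<in> carrier_mat n1 n2"
  shows "(fro_norm A)\<^sup>2 = fro_ip n1 n2 (\<lambda>i l. A $$ (i, l)) (\<lambda>i l. A $$ (i, l))"
  using assms by (simp add: fro_norm_def fro_ip_def power2_eq_square sum_nonneg)

lemma fro_norm_nonneg: "0 \<le> fro_norm A"
  by (simp add: fro_norm_def sum_nonneg)

text \<open>Beyond \<open>n2\<close> this is the default value of \<open>sigma\<close>. Beyond the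
  rank or \<open>n1\<close> it comes from a factorization of that inner dimension; for
  \<open>n1\<close> the trivial one, identity times \<open>A\<close>, suffices.\<close>

lemma sigma_eq_0:
  assumes A: "A \<in> carrier_mat n1 n2" and j: "min (mat_rank A) (min n1 n2) \<le> j"
  shows "sigma A (Suc j) = 0"
proof (cases "j < n2")
  case False
  thus ?thesis by (simp add: sigma_def svd_exists(1)[OF A])
next
  case True
  obtain u v where "svd_of n1 n2 (\<lambda>i l. A $$ (i, l)) (\<lambda>j. sigma A (Suc j)) u v"
    using svd_exists(2)[OF A] by blast
  then interpret svd_of n1 n2 "\<lambda>i l. A $$ (i, l)" "\<lambda>j. sigma A (Suc j)" u v .
  obtain F G where FG: "\<And>i l. i < n1 \<Longrightarrow> l < n2 \<Longrightarrow> A $$ (i, l) = (\<Sum>t<mat_rank A. F i t * G t l)"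
    using rank_factorization[OF A] by blast
  have triv: "A $$ (i, l) = (\<Sum>t<n1. (if t = i then 1 else 0) * A $$ (t, l))" if "i < n1" for i l
  proof -
    have "(\<Sum>t<n1. (if t = i then 1 else 0) * A $$ (t, l)) = (\<Sum>t<n1. if t = i then A $$ (t, l) else 0)"
      by (intro sum.cong) auto
    thus ?thesis using that by simp
  qed
  from j True consider "mat_rank A \<le> j" | "n1 \<le> j" by linarith
  thus ?thesis
  proof cases
    case 1
    show ?thesis by (rule sing_eq_0_of_factorization[OF FG 1 True])
  next
    case 2
    show ?thesis by (rule sing_eq_0_of_factorization[OF triv 2 True])
  qed
qed

lemma sigma_nonneg:
  assumes A: "A \<in> carrier_mat n1 n2"
  shows "0 \<le> sigma A (Suc j)"
proof (cases "j < n2")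
  case True
  thus ?thesis using svd_exists(2)[OF A] by (auto dest: svd_of.nonneg)
qed (simp add: sigma_def svd_exists(1)[OF A])

lemma fro_norm_square_eq_sum:
  assumes A: "A \<in> carrier_mat n1 n2"
  shows "(fro_norm A)\<^sup>2 = (\<Sum>j<n2. (sigma A (Suc j))\<^sup>2)"
  using svd_exists(2)[OF A] fro_norm_square[OF A] by (auto dest: svd_of.fro_ip_self)

lemma sum_eq_truncation:
  fixes h :: "nat \<Rightarrow> real"
  assumes "\<And>j. M \<le> j \<Longrightarrow> h j = 0" "M \<le> n"
  shows "(\<Sum>j<n. h j) = (\<Sum>j<M. h j)"
  using assms by (intro sum.mono_neutral_right) auto

text \<open>\<open>r\<close> may exceed \<open>min n1 n2\<close>: then the second sum is empty and
  the surplus terms of the first are 0.\<close>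

lemma nuc_norm_split:
  assumes A: "A \<in> carrier_mat n1 n2"
  shows "nuc_norm A = (\<Sum>j<r. sigma A (Suc j)) + (\<Sum>j\<in>{r..<min n1 n2}. sigma A (Suc j))"
proof -
  have zero: "sigma A (Suc j) = 0" if "min n1 n2 \<le> j" for j using sigma_eq_0[OF A] that by simp
  have nuc: "nuc_norm A = (\<Sum>j<min n1 n2. sigma A (Suc j))"
    unfolding nuc_norm_eq_sum[OF A] by (rule sum_eq_truncation) (use zero in auto)
  show ?thesis
  proof (cases "r \<le> min n1 n2")
    case True
    thus ?thesis unfolding nuc lessThan_atLeast0 by (simp add: sum.atLeastLessThan_concat)
  next
    case False
    hence "{r..<min n1 n2} = {}" "min n1 n2 \<le> r" by auto
    thus ?thesis unfolding nuc using sum_eq_truncation[of "min n1 n2" "\<lambda>j. sigma A (Suc j)" r] zero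
      by (simp only: sum.empty)
  qed
qed

lemma sum_sigma_le_fro_norm:
  assumes A: "A \<in> carrier_mat n1 n2"
  shows "(\<Sum>j<r. sigma A (Suc j)) \<le> sqrt (real r) * fro_norm A"
proof -
  have "(\<Sum>j<r. sigma A (Suc j))\<^sup>2 \<le> (\<Sum>j<r. (sigma A (Suc j))\<^sup>2) * real r"
    using sum_squared_le_sum_of_squares[of "\<lambda>j. sigma A (Suc j)" "{..<r}"] by simp
  \<comment> \<open>The limit \<open>max r n2\<close> also covers \<open>r > n2\<close>, where the
    additional terms are 0.\<close>
  also have "(\<Sum>j<r. (sigma A (Suc j))\<^sup>2) \<le> (\<Sum>j<max r n2. (sigma A (Suc j))\<^sup>2)"
    by (rule sum_mono2) auto
  also have "\<dots> = (fro_norm A)\<^sup>2"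
    unfolding fro_norm_square_eq_sum[OF A] using sigma_eq_0[OF A] by (intro sum_eq_truncation) auto
  finally have "(\<Sum>j<r. sigma A (Suc j))\<^sup>2 \<le> (sqrt (real r) * fro_norm A)\<^sup>2"
    by (simp add: power_mult_distrib mult.commute mult_right_mono)
  thus ?thesis by (rule power2_le_imp_le) (simp add: fro_norm_nonneg)
qed

lemma fro_norm_pos:
  assumes A: "A \<in> carrier_mat n1 n2" and "A \<noteq> 0\<^sub>m n1 n2"
  shows "0 < (fro_norm A)\<^sup>2"
proof -
  obtain i l where "i < n1" "l < n2" "A $$ (i, l) \<noteq> 0"
    using assms by (metis carrier_matD eq_matI index_zero_mat)
  hence "0 < (\<Sum>i<n1. \<Sum>l<n2. A $$ (i, l) * A $$ (i, l))"
    by (intro sum_pos2[where i = i] sum_pos2[where i = l] sum_nonneg) (auto simp: zero_less_mult_iff)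
  thus ?thesis unfolding fro_norm_square[OF A] fro_ip_def .
qed

lemma sum_sigma_shift:
  "(\<Sum>i=1..r. sigma A i) = (\<Sum>j<r. sigma A (Suc j))"
  "(\<Sum>i\<in>{r<..n}. sigma A i) = (\<Sum>j\<in>{r..<n}. sigma A (Suc j))"
proof -
  show "(\<Sum>i=1..r. sigma A i) = (\<Sum>j<r. sigma A (Suc j))"
    by (rule sum.reindex_bij_witness[of _ Suc "\<lambda>i. i - 1"]) auto
  show "(\<Sum>i\<in>{r<..n}. sigma A i) = (\<Sum>j\<in>{r..<n}. sigma A (Suc j))"
    by (rule sum.reindex_bij_witness[of _ Suc "\<lambda>i. i - 1"]) auto
qed

section \<open>The null space inequality and unique recovery\<close>

text \<open>Adding the first \<open>r\<close> singular values to both sides leaves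
  \<open>1 + \<kappa>\<close> times their sum against the nuclear norm. For
  \<open>\<kappa> = 1 + c / \<alpha>\<close> this factor is \<open>2 + c / \<alpha>\<close>.\<close>

lemma null_space_inequality:
  assumes H: "H \<in> carrier_mat n1 n2" and \<Delta>: "\<Delta> > 0" and \<kappa>: "\<kappa> \<ge> 0"
    and nsp: "nuc_norm H \<ge> sqrt (m / \<Delta>) * fro_norm H" and m: "m \<ge> (1 + \<kappa>)\<^sup>2 * real r * \<Delta>"
  shows "\<kappa> * (\<Sum>j<r. sigma H (Suc j)) \<le> (\<Sum>j\<in>{r..<min n1 n2}. sigma H (Suc j))"
proof -
  have "(1 + \<kappa>) * (\<Sum>j<r. sigma H (Suc j)) \<le> (1 + \<kappa>) * (sqrt (real r) * fro_norm H)"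
    using \<kappa> by (intro mult_left_mono sum_sigma_le_fro_norm[OF H]) auto
  also have "\<dots> = sqrt ((1 + \<kappa>)\<^sup>2 * real r) * fro_norm H"
    using \<kappa> by (simp add: real_sqrt_mult)
  also have "\<dots> \<le> sqrt (m / \<Delta>) * fro_norm H"
    using m \<Delta> by (intro mult_right_mono fro_norm_nonneg) (simp add: pos_le_divide_eq)
  also have "\<dots> \<le> nuc_norm H" by (rule nsp)
  finally show ?thesis unfolding nuc_norm_split[OF H, of r] by (simp add: algebra_simps)
qed

text \<open>The nuclear norm changes by at least \<open>T' - T\<close> and the cross term costs at
  most \<open>c * T / \<alpha>\<close>; the null space inequality makes the balance nonnegative. The
  squared norm of the nonzero \<open>H\<close> then gives strictness.\<close>

lemma N2_obj_less:
  assumes X: "X \<in> carrier_mat n1 n2" and H: "H \<in> carrier_mat n1 n2" and H0: "H \<noteq> 0\<^sub>m n1 n2"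
    and rank: "mat_rank X \<le> r" and spec: "spec_norm X = c" and \<alpha>: "\<alpha> > 0"
    and nsp: "(1 + c / \<alpha>) * (\<Sum>j<r. sigma H (Suc j)) \<le> (\<Sum>j\<in>{r..<min n1 n2}. sigma H (Suc j))"
  shows "N2_obj \<alpha> X < N2_obj \<alpha> (X + H)"
proof -
  \<comment> \<open>The perturbation bound needs \<open>r\<close> to be at most both dimensions.
    Capping it discards only singular values equal to 0.\<close>
  define r' where "r' = min r (min n1 n2)"
  define T where "T = (\<Sum>j<r'. sigma H (Suc j))"
  define T' where "T' = (\<Sum>j\<in>{r'..<min n1 n2}. sigma H (Suc j))"
  have Y: "X + H \<in> carrier_mat n1 n2" using X H by simp
  let ?x = "\<lambda>i l. X $$ (i, l)" and ?h = "\<lambda>i l. H $$ (i, l)" and ?y = "\<lambda>i l. (X + H) $$ (i, l)"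
  obtain u v where svdX: "svd_of n1 n2 ?x (\<lambda>j. sigma X (Suc j)) u v" using svd_exists(2)[OF X] by blast
  obtain a b where svdH: "svd_of n1 n2 ?h (\<lambda>j. sigma H (Suc j)) a b" using svd_exists(2)[OF H] by blast
  obtain p g where svdY: "svd_of n1 n2 ?y (\<lambda>j. sigma (X + H) (Suc j)) p g" using svd_exists(2)[OF Y] by blast
  have y: "?y i l = ?x i l + ?h i l" if "i < n1" "l < n2" for i l using that X H by simp
  have X0: "sigma X (Suc j) = 0" if "r' \<le> j" for j
    using sigma_eq_0[OF X, of j] that rank by (auto simp: r'_def)
  have c: "c = sigma X (Suc 0)" using spec by (simp add: spec_norm_def)
  have nuc: "nuc_norm X + T' - T \<le> nuc_norm (X + H)"
  proof -
    have "nuc_norm X = (\<Sum>j<r'. sigma X (Suc j))"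
      unfolding nuc_norm_split[OF X, of r'] using X0 by simp
    moreover have "r' \<le> n1" "r' \<le> n2" by (auto simp: r'_def)
    ultimately show ?thesis
      using nuclear_perturbation_low_rank[OF svdX svdH svdY y X0, of r']
      by (simp add: T_def T'_def nuc_norm_eq_sum[OF Y])
  qed
  have ip: "- (c * T) \<le> fro_ip n1 n2 ?x ?h"
    unfolding T_def
    by (rule von_Neumann_low_rank[OF svdX svdH])
      (auto simp: c r'_def X0 sigma_nonneg[OF X] intro: svd_of.decreasing[OF svdX] X0[unfolded r'_def])
  have fro: "(fro_norm (X + H))\<^sup>2 = (fro_norm X)\<^sup>2 + 2 * fro_ip n1 n2 ?x ?h + (fro_norm H)\<^sup>2"
  proof -
    have "(fro_norm (X + H))\<^sup>2 = (\<Sum>i<n1. \<Sum>l<n2. (?x i l + ?h i l) * (?x i l + ?h i l))"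
      unfolding fro_norm_square[OF Y] fro_ip_def by (intro sum.cong refl) (simp add: y)
    also have "\<dots> = (\<Sum>i<n1. \<Sum>l<n2. ?x i l * ?x i l + 2 * (?x i l * ?h i l) + ?h i l * ?h i l)"
      by (intro sum.cong refl) (simp add: algebra_simps)
    finally show ?thesis
      unfolding fro_norm_square[OF X] fro_norm_square[OF H] fro_ip_def
      by (simp add: sum.distrib sum_distrib_left)
  qed
  have nsp': "(1 + c / \<alpha>) * T \<le> T'"
  proof (cases "r \<le> min n1 n2")
    case True
    thus ?thesis using nsp by (simp add: T_def T'_def r'_def)
  next
    case False
    hence "{r..<min n1 n2} = {}" "r' = min n1 n2" by (auto simp: r'_def)
    moreover have "(\<Sum>j<r. sigma H (Suc j)) = (\<Sum>j<min n1 n2. sigma H (Suc j))"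
      using False sigma_eq_0[OF H] by (intro sum_eq_truncation) auto
    ultimately show ?thesis using nsp by (simp only: T_def T'_def sum.empty atLeastLessThan_empty order_refl)
  qed
  define K where "K = c * T / \<alpha>"
  define I where "I = fro_ip n1 n2 ?x ?h / \<alpha>"
  define F where "F = (fro_norm H)\<^sup>2 / (2 * \<alpha>)"
  have "N2_obj \<alpha> (X + H) = N2_obj \<alpha> X + (nuc_norm (X + H) - nuc_norm X) + I + F"
    unfolding N2_obj_def fro I_def F_def using \<alpha> by (simp add: field_simps)
  moreover have "- K \<le> I"
    using divide_right_mono[OF ip, of \<alpha>] \<alpha> by (simp add: K_def I_def)
  moreover have "F > 0" using fro_norm_pos[OF H H0] \<alpha> by (simp add: F_def)
  moreover have "T + K \<le> T'" using nsp' by (simp add: K_def algebra_simps)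
  ultimately show ?thesis using nuc by linarith
qed

theorem mainTheorem12:
  fixes n1 n2 m r :: nat and \<A> :: "real mat \<Rightarrow> real vec" and \<Delta> c \<alpha> :: real
  assumes lin: "lin_meas n1 n2 m \<A>"
    and Delta_pos: "\<Delta> > 0"
    and nsp: "\<forall>H \<in> null_space_op n1 n2 m \<A>. H \<noteq> 0\<^sub>m n1 n2 \<longrightarrow>
                 nuc_norm H \<ge> sqrt (real m / \<Delta>) * fro_norm H"
    and c_pos: "c > 0" and alpha_pos: "\<alpha> > 0"
    and m_ge: "real m \<ge> (2 + c / \<alpha>)\<^sup>2 * real r * \<Delta>"
  shows "(\<forall>H \<in> null_space_op n1 n2 m \<A>.
            (1 + c / \<alpha>) * (\<Sum>i=1..r. sigma H i) \<le> (\<Sum>i\<in>{r<..min n1 n2}. sigma H i))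
       \<and> (\<forall>X0 \<in> carrier_mat n1 n2. mat_rank X0 \<le> r \<longrightarrow> spec_norm X0 = c \<longrightarrow>
            N2_unique_sol n1 n2 \<A> (\<A> X0) \<alpha> X0)"
proof -
  have null: "(1 + c / \<alpha>) * (\<Sum>j<r. sigma H (Suc j)) \<le> (\<Sum>j\<in>{r..<min n1 n2}. sigma H (Suc j))"
    if H: "H \<in> null_space_op n1 n2 m \<A>" for H
  proof (rule null_space_inequality[OF _ Delta_pos])
    show car: "H \<in> carrier_mat n1 n2" using H by (simp add: null_space_op_def)
    show "0 \<le> 1 + c / \<alpha>" using c_pos alpha_pos by simp
    show "sqrt (real m / \<Delta>) * fro_norm H \<le> nuc_norm H"
    \<comment> \<open>The assumption concerns nonzero \<open>H\<close> only; for
      \<open>H = 0\<close> the Frobenius norm vanishes.\<close>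
    proof (cases "H = 0\<^sub>m n1 n2")
      case True
      have "0 \<le> nuc_norm H" unfolding nuc_norm_eq_sum[OF car] by (intro sum_nonneg sigma_nonneg[OF car])
      moreover have "fro_norm H = 0" by (simp add: True fro_norm_def)
      ultimately show ?thesis by simp
    qed (use nsp H in blast)
    show "(1 + (1 + c / \<alpha>))\<^sup>2 * real r * \<Delta> \<le> real m" using m_ge by simp
  qed
  have "N2_obj \<alpha> X < N2_obj \<alpha> Y"
    if X: "X \<in> carrier_mat n1 n2" and rank: "mat_rank X \<le> r" and spec: "spec_norm X = c"
      and Y: "Y \<in> carrier_mat n1 n2" and eq: "\<A> Y = \<A> X" and neq: "Y \<noteq> X" for X Y
  proof -
    \<comment> \<open>The difference is written with a scalar multiple to match the additivity and
      homogeneity in \<open>lin_meas\<close>.\<close>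
    define H where "H = Y + (- 1) \<cdot>\<^sub>m X"
    have H: "H \<in> carrier_mat n1 n2" using X Y by (simp add: H_def)
    have "\<A> H = \<A> X + (- 1) \<cdot>\<^sub>v \<A> X"
      using lin X Y eq by (simp add: H_def lin_meas_def)
    also have "\<dots> = 0\<^sub>v m"
    proof -
      have "\<A> X \<in> carrier_vec m" using lin X by (simp add: lin_meas_def)
      thus ?thesis by (intro eq_vecI) auto
    qed
    finally have "H \<in> null_space_op n1 n2 m \<A>" using H by (simp add: null_space_op_def)
    moreover have YH: "Y = X + H" using X Y by (intro eq_matI) (auto simp: H_def)
    moreover have "H \<noteq> 0\<^sub>m n1 n2" using neq YH X by auto
    ultimately show ?thesis
      using N2_obj_less[OF X H _ rank spec alpha_pos null] by simp
  qed
  thus ?thesis unfolding sum_sigma_shift N2_unique_sol_def using null by blast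
qed

end
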